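(* Transport the action of the braid group generated by the Zhelobenko automorphisms $\check{\mathrm q}_i$, $i=1,\dots,n-1$ (extended from $\mathrm{Diff}_{\mathbf h}(n)$ to $\mathrm S_x^{-1}\mathrm{Diff}_{\mathbf h}(n)$), by the isomorphism $\mu$ to an action by automorphisms on $\mathfrak{k}[a_1,\dots,a_n]\otimes\mathrm T^{-1}\mathrm W_n$. This action preserves the subring $\mathrm T^{-1}\mathrm W_n$. Moreover, the operators $\check{\mathrm q}_i$ preserve the subring $\mathrm T_0^{-1}\mathrm W_n$, where $\mathrm T_0\subset\mathrm T$ is the multiplicative set generated by $X^jD_j-X^kD_k+\ell$, $1\le j<k\le n$, $\ell\in\mathbb Z$, and they act by $$\check{\mathrm q}_i(X^i)=\frac{1}{\mathcal H_{i,i+1}}X^{i+1},\quad \check{\mathrm q}_i(X^{i+1})=X^i\mathcal H_{i,i+1},\quad \check{\mathrm q}_i(X^j)=X^j\ \text{for } j\ne i,i+1,$$ $$\check{\mathrm q}_i(D_i)=D_{i+1}\mathcal H_{i,i+1},\quad \check{\mathrm q}_i(D_{i+1})=\frac{1}{\mathcal H_{i,i+1}}D_i,\quad \check{\mathrm q}_i(D_j)=D_j\ \text{for } j\ne i,i+1,$$ where $\mathcal H_j:=D_jX^j$ and $\mathcal H_{jk}:=\mathcal H_j-\mathcal H_k$.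
   Context: $n\ge 1$ is an integer; $\mathfrak{k}$ is a commutative integral domain of characteristic zero (the ground ring). $\mathrm{U}(\mathbf h)=\mathfrak{k}[\tilde h_1,\dots,\tilde h_n]$ is the polynomial ring; $\tilde h_{ij}:=\tilde h_i-\tilde h_j$; $\bar{\mathrm U}(\mathbf h)$ is the localization of $\mathrm{U}(\mathbf h)$ at the multiplicative set generated by all $\tilde h_{ij}+k$, $i\ne j$, $k\in\mathbb{Z}$. The ring $\mathrm{Diff}_{\mathbf h}(n)$ of $\mathbf h$-deformed differential operators of type A is the $\mathfrak k$-algebra generated by $\bar{\mathrm U}(\mathbf h)$ and elements $x^j,\bar\partial_j$, $j=1,\dots,n$, with defining relations (for all indices, besides those of $\bar{\mathrm U}(\mathbf h)$; relations for $\tilde h_i$ extend to all of $\bar{\mathrm U}(\mathbf h)$): $$\tilde h_i x^j=x^j(\tilde h_i+\delta_i^j),\qquad \tilde h_i\bar\partial_j=\bar\partial_j(\tilde h_i-\delta_i^j),$$ $$x^ix^j=\frac{\tilde h_{ij}+1}{\tilde h_{ij}}x^jx^i\ (i<j),\qquad \bar\partial_i\bar\partial_j=\frac{\tilde h_{ij}-1}{\tilde h_{ij}}\bar\partial_j\bar\partial_i\ (i<j),$$ $$x^i\bar\partial_j=\bar\partial_jx^i\ (i<j),\qquad x^i\bar\partial_j=\frac{\tilde h_{ij}(\tilde h_{ij}-2)}{(\tilde h_{ij}-1)^2}\bar\partial_jx^i\ (i>j),\qquad x^i\bar\partial_i=\sum_{j=1}^n\frac{1}{1-\tilde h_{ij}}\bar\partial_jx^j-1.$$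 It is free as a one-sided $\bar{\mathrm U}(\mathbf h)$-module and has no zero divisors. $\mathrm{S}_x^{-1}\mathrm{Diff}_{\mathbf h}(n)$ is its (Ore) localization at the multiplicative set $\mathrm S_x$ generated by $x^1,\dots,x^n$. The Zhelobenko automorphisms $\check{\mathrm q}_i$, $i=1,\dots,n-1$, of $\mathrm{Diff}_{\mathbf h}(n)$ (which are known to be automorphisms generating an action of the braid group) are $$\check{\mathrm q}_i(x^i)=-x^{i+1}\frac{\tilde h_{i,i+1}}{\tilde h_{i,i+1}-1},\quad \check{\mathrm q}_i(x^{i+1})=x^i,\quad \check{\mathrm q}_i(x^j)=x^j\ (j\ne i,i+1),$$ $$\check{\mathrm q}_i(\bar\partial_i)=-\frac{\tilde h_{i,i+1}-1}{\tilde h_{i,i+1}}\bar\partial_{i+1},\quad \check{\mathrm q}_i(\bar\partial_{i+1})=\bar\partial_i,\quad \check{\mathrm q}_i(\bar\partial_j)=\bar\partial_j\ (j\ne i,i+1),\quad \check{\mathrm q}_i(\tilde h_j)=\tilde h_{s_i(j)},$$ with $s_i$ the transposition $(i,i+1)$. The Weyl algebra $\mathrm W_n$ is the $\mathfrak k$-algebra with generators $X^j,D_j$, $j=1,\dots,n$, and relations $X^iX^j=X^jX^i$, $D_iD_j=D_jD_i$, $D_iX^j=\delta_i^j+X^jD_i$. $\mathrm T^{-1}\mathrm W_n$ is its (Ore) localization at the multiplicative set $\mathrm T$ generated by $X^jD_j-X^kD_k+\ell$ ($1\le j<k\le n$, $\ell\in\mathbb Z$) and $X^j$ ($1\le j\le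 n$). $a_1,\dots,a_n$ are commuting indeterminates. Let $\psi_i':=\prod_{k<i}\tilde h_{ik}$, $\Gamma_j:=\bar\partial_jx^j$, $e_k$ the $k$-th elementary symmetric function of $\tilde h_1,\dots,\tilde h_n$, and $c_k:=\sum_j\frac{\partial e_k}{\partial\tilde h_j}\Gamma_j-e_k$. The ring isomorphism $\mu\colon\mathfrak{k}[a_1,\dots,a_n]\otimes\mathrm T^{-1}\mathrm W_n\to\mathrm S_x^{-1}\mathrm{Diff}_{\mathbf h}(n)$ is the one determined by $X^i\mapsto x^i\psi_i'$, $\mathcal H_i\mapsto\tilde h_i$, $a_i\mapsto c_i$, $i=1,\dots,n$. *)

theory Defs
  imports "HOL-Algebra.Algebra"
begin

section \<open>Algebras given by generators and relations\<close>

text \<open>Noncommutative polynomial expressions over a ground ring. The arithmetic instances below are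
  purely syntactic (they are the constructors); the algebra laws are imposed by \<open>alg_eq\<close>.\<close>

datatype ('k, alg_gens: 'g) alg_term =
    Const 'k
  | Gen 'g
  | Plus "('k, 'g) alg_term" "('k, 'g) alg_term"
  | Neg "('k, 'g) alg_term"
  | Times "('k, 'g) alg_term" "('k, 'g) alg_term"

instantiation alg_term :: ("{zero,one}", type) "{zero,one,plus,uminus,minus,times}"
begin
definition zero_alg_term :: "('a, 'b) alg_term" where "0 = Const 0"
definition one_alg_term :: "('a, 'b) alg_term" where "1 = Const 1"
definition plus_alg_term :: "('a, 'b) alg_term \<Rightarrow> ('a, 'b) alg_term \<Rightarrow> ('a, 'b) alg_term"
  where "s + t = Plus s t"
definition uminus_alg_term :: "('a, 'b) alg_term \<Rightarrow> ('a, 'b) alg_term" where "- t = Neg t"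
definition minus_alg_term :: "('a, 'b) alg_term \<Rightarrow> ('a, 'b) alg_term \<Rightarrow> ('a, 'b) alg_term"
  where "s - t = Plus s (Neg t)"
definition times_alg_term :: "('a, 'b) alg_term \<Rightarrow> ('a, 'b) alg_term \<Rightarrow> ('a, 'b) alg_term"
  where "s * t = Times s t"
instance ..
end

lemmas alg_term_syntax =
  zero_alg_term_def one_alg_term_def plus_alg_term_def uminus_alg_term_def
  minus_alg_term_def times_alg_term_def

fun tsum :: "('k::{zero,one}, 'g) alg_term list \<Rightarrow> ('k, 'g) alg_term" where
  "tsum [] = 0"
| "tsum (t # ts) = t + tsum ts"

fun tprod :: "('k::{zero,one}, 'g) alg_term list \<Rightarrow> ('k, 'g) alg_term" where
  "tprod [] = 1"
| "tprod (t # ts) = t * tprod ts"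

text \<open>The smallest congruence containing the laws of unital associative algebras over the ground
  ring and the given relations.\<close>

inductive alg_eq ::
  "(('k::comm_ring_1, 'g) alg_term \<times> ('k, 'g) alg_term) set
     \<Rightarrow> ('k, 'g) alg_term \<Rightarrow> ('k, 'g) alg_term \<Rightarrow> bool"
  for R where
  refl: "alg_eq R t t"
| sym: "alg_eq R s t \<Longrightarrow> alg_eq R t s"
| trans: "alg_eq R s t \<Longrightarrow> alg_eq R t u \<Longrightarrow> alg_eq R s u"
| cong_plus: "alg_eq R s s' \<Longrightarrow> alg_eq R t t' \<Longrightarrow> alg_eq R (s + t) (s' + t')"
| cong_neg: "alg_eq R s s' \<Longrightarrow> alg_eq R (- s) (- s')"
| cong_times: "alg_eq R s s' \<Longrightarrow> alg_eq R t t' \<Longrightarrow> alg_eq R (s * t) (s' * t')"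
| plus_assoc: "alg_eq R ((s + t) + u) (s + (t + u))"
| plus_comm: "alg_eq R (s + t) (t + s)"
| plus_zero: "alg_eq R (0 + t) t"
| plus_neg: "alg_eq R (- t + t) 0"
| times_assoc: "alg_eq R ((s * t) * u) (s * (t * u))"
| one_times: "alg_eq R (1 * t) t"
| times_one: "alg_eq R (t * 1) t"
| distrib_right: "alg_eq R ((s + t) * u) (s * u + t * u)"
| distrib_left: "alg_eq R (u * (s + t)) (u * s + u * t)"
| const_plus: "alg_eq R (Const (a + b)) (Const a + Const b)"
| const_times: "alg_eq R (Const (a * b)) (Const a * Const b)"
| const_central: "alg_eq R (Const a * t) (t * Const a)"
| rel: "(s, t) \<in> R \<Longrightarrow> alg_eq R s t"

text \<open>The congruence lives on all terms, but only terms over \<open>G\<close> represent elements. If the relations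
  only involve generators in \<open>G\<close>, this identifies no more terms over \<open>G\<close> than the congruence
  on terms over \<open>G\<close> does (send the other generators to \<open>0\<close>).\<close>

definition alg_cls ::
  "'g set \<Rightarrow> (('k::comm_ring_1, 'g) alg_term \<times> ('k, 'g) alg_term) set
     \<Rightarrow> ('k, 'g) alg_term \<Rightarrow> ('k, 'g) alg_term set"
  where "alg_cls G R t = {u. alg_gens u \<subseteq> G \<and> alg_eq R t u}"

definition presented_alg ::
  "'g set \<Rightarrow> (('k::comm_ring_1, 'g) alg_term \<times> ('k, 'g) alg_term) set
     \<Rightarrow> ('k, 'g) alg_term set ring"
  where "presented_alg G R =
    \<lparr> carrier = alg_cls G R ` {t. alg_gens t \<subseteq> G},
      monoid.mult = (\<lambda>A B. \<Union>a\<in>A. \<Union>b\<in>B. alg_cls G R (a * b)),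
      monoid.one = alg_cls G R 1,
      ring.zero = alg_cls G R 0,
      ring.add = (\<lambda>A B. \<Union>a\<in>A. \<Union>b\<in>B. alg_cls G R (a + b)) \<rparr>"

lemma alg_cls_eqI: "alg_eq R s t \<Longrightarrow> alg_cls G R s = alg_cls G R t"
  unfolding alg_cls_def using alg_eq.sym alg_eq.trans by blast

lemma alg_cls_eq_iff:
  "alg_gens t \<subseteq> G \<Longrightarrow> alg_cls G R s = alg_cls G R t \<longleftrightarrow> alg_eq R s t"
  using alg_cls_eqI[of R s t G] alg_eq.refl[of R t] by (auto simp: alg_cls_def)

lemma alg_cls_rel: "(s, t) \<in> R \<Longrightarrow> alg_cls G R s = alg_cls G R t"
  by (intro alg_cls_eqI alg_eq.rel)

lemma alg_gens_simps [simp]: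
  "alg_gens (s + t) = alg_gens s \<union> alg_gens t"
  "alg_gens (s * t) = alg_gens s \<union> alg_gens t"
  "alg_gens (s - t) = alg_gens s \<union> alg_gens t"
  "alg_gens (- t) = alg_gens t"
  "alg_gens (0 :: ('k::{zero,one}, 'g) alg_term) = {}"
  "alg_gens (1 :: ('k::{zero,one}, 'g) alg_term) = {}"
  for s t :: "('k::{zero,one}, 'g) alg_term"
  by (simp_all add: alg_term_syntax)

lemma presented_alg_carrier_iff:
  "A \<in> carrier (presented_alg G R) \<longleftrightarrow> (\<exists>t. alg_gens t \<subseteq> G \<and> A = alg_cls G R t)"
  by (auto simp: presented_alg_def)

lemma presented_alg_mult:
  assumes "alg_gens s \<subseteq> G" "alg_gens t \<subseteq> G"
  shows "alg_cls G R s \<otimes>\<^bsub>presented_alg G R\<^esub> alg_cls G R t = alg_cls G R (s * t)"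
proof -
  have "alg_cls G R (a * b) = alg_cls G R (s * t)"
    if "a \<in> alg_cls G R s" "b \<in> alg_cls G R t" for a b
    using that by (intro alg_cls_eqI alg_eq.cong_times) (auto simp: alg_cls_def intro: alg_eq.sym)
  moreover have "s \<in> alg_cls G R s" "t \<in> alg_cls G R t"
    using assms by (auto simp: alg_cls_def intro: alg_eq.refl)
  ultimately have "(\<Union>a\<in>alg_cls G R s. \<Union>b\<in>alg_cls G R t. alg_cls G R (a * b)) = alg_cls G R (s * t)"
    by blast
  then show ?thesis by (simp add: presented_alg_def)
qed

lemma presented_alg_add:
  assumes "alg_gens s \<subseteq> G" "alg_gens t \<subseteq> G"
  shows "alg_cls G R s \<oplus>\<^bsub>presented_alg G R\<^esub> alg_cls G R t = alg_cls G R (s + t)"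
proof -
  have "alg_cls G R (a + b) = alg_cls G R (s + t)"
    if "a \<in> alg_cls G R s" "b \<in> alg_cls G R t" for a b
    using that by (intro alg_cls_eqI alg_eq.cong_plus) (auto simp: alg_cls_def intro: alg_eq.sym)
  moreover have "s \<in> alg_cls G R s" "t \<in> alg_cls G R t"
    using assms by (auto simp: alg_cls_def intro: alg_eq.refl)
  ultimately have "(\<Union>a\<in>alg_cls G R s. \<Union>b\<in>alg_cls G R t. alg_cls G R (a + b)) = alg_cls G R (s + t)"
    by blast
  then show ?thesis by (simp add: presented_alg_def)
qed

lemma presented_alg_one: "\<one>\<^bsub>presented_alg G R\<^esub> = alg_cls G R 1"
  and presented_alg_zero: "\<zero>\<^bsub>presented_alg G R\<^esub> = alg_cls G R 0"
  by (simp_all add: presented_alg_def)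

lemma presented_alg_ring: "ring (presented_alg G R)"
proof (intro ringI abelian_groupI monoidI)
  let ?A = "presented_alg G R"
  note ops = presented_alg_carrier_iff presented_alg_mult presented_alg_add
    presented_alg_one presented_alg_zero
  fix x y z assume "x \<in> carrier ?A" "y \<in> carrier ?A" "z \<in> carrier ?A"
  then obtain r s t where [simp]: "x = alg_cls G R r" "y = alg_cls G R s" "z = alg_cls G R t"
    "alg_gens r \<subseteq> G" "alg_gens s \<subseteq> G" "alg_gens t \<subseteq> G"
    by (auto simp: presented_alg_carrier_iff)
  show "x \<otimes>\<^bsub>?A\<^esub> y \<otimes>\<^bsub>?A\<^esub> z = x \<otimes>\<^bsub>?A\<^esub> (y \<otimes>\<^bsub>?A\<^esub> z)"
    by (simp add: ops alg_cls_eqI[OF alg_eq.times_assoc])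
  show "x \<oplus>\<^bsub>?A\<^esub> y \<oplus>\<^bsub>?A\<^esub> z = x \<oplus>\<^bsub>?A\<^esub> (y \<oplus>\<^bsub>?A\<^esub> z)"
    by (simp add: ops alg_cls_eqI[OF alg_eq.plus_assoc])
  show "(x \<oplus>\<^bsub>?A\<^esub> y) \<otimes>\<^bsub>?A\<^esub> z = x \<otimes>\<^bsub>?A\<^esub> z \<oplus>\<^bsub>?A\<^esub> y \<otimes>\<^bsub>?A\<^esub> z"
    by (simp add: ops alg_cls_eqI[OF alg_eq.distrib_right])
  show "z \<otimes>\<^bsub>?A\<^esub> (x \<oplus>\<^bsub>?A\<^esub> y) = z \<otimes>\<^bsub>?A\<^esub> x \<oplus>\<^bsub>?A\<^esub> z \<otimes>\<^bsub>?A\<^esub> y"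
    by (simp add: ops alg_cls_eqI[OF alg_eq.distrib_left])
next
  let ?A = "presented_alg G R"
  note ops = presented_alg_carrier_iff presented_alg_mult presented_alg_add
    presented_alg_one presented_alg_zero
  fix x y assume "x \<in> carrier ?A" "y \<in> carrier ?A"
  then obtain r s where [simp]: "x = alg_cls G R r" "y = alg_cls G R s"
    "alg_gens r \<subseteq> G" "alg_gens s \<subseteq> G"
    by (auto simp: presented_alg_carrier_iff)
  show "x \<otimes>\<^bsub>?A\<^esub> y \<in> carrier ?A"
    by (simp add: ops) (metis alg_gens_simps(2) Un_least \<open>alg_gens r \<subseteq> G\<close> \<open>alg_gens s \<subseteq> G\<close>)
  show "x \<oplus>\<^bsub>?A\<^esub> y \<in> carrier ?A"
    by (simp add: ops) (metis alg_gens_simps(1) Un_least \<open>alg_gens r \<subseteq> G\<close> \<open>alg_gens s \<subseteq> G\<close>)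
  show "x \<oplus>\<^bsub>?A\<^esub> y = y \<oplus>\<^bsub>?A\<^esub> x"
    by (simp add: ops alg_cls_eqI[OF alg_eq.plus_comm])
next
  let ?A = "presented_alg G R"
  note ops = presented_alg_carrier_iff presented_alg_mult presented_alg_add
    presented_alg_one presented_alg_zero
  fix x assume "x \<in> carrier ?A"
  then obtain r where [simp]: "x = alg_cls G R r" "alg_gens r \<subseteq> G"
    by (auto simp: presented_alg_carrier_iff)
  show "\<one>\<^bsub>?A\<^esub> \<otimes>\<^bsub>?A\<^esub> x = x" "x \<otimes>\<^bsub>?A\<^esub> \<one>\<^bsub>?A\<^esub> = x"
    by (simp_all add: ops alg_cls_eqI[OF alg_eq.one_times] alg_cls_eqI[OF alg_eq.times_one])
  show "\<zero>\<^bsub>?A\<^esub> \<oplus>\<^bsub>?A\<^esub> x = x"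
    by (simp add: ops alg_cls_eqI[OF alg_eq.plus_zero])
  have "alg_cls G R (- r) \<oplus>\<^bsub>?A\<^esub> x = \<zero>\<^bsub>?A\<^esub>"
    by (simp add: ops alg_cls_eqI[OF alg_eq.plus_neg])
  moreover have "alg_cls G R (- r) \<in> carrier ?A"
    unfolding presented_alg_carrier_iff by (rule exI[of _ "- r"]) simp
  ultimately show "\<exists>y\<in>carrier ?A. y \<oplus>\<^bsub>?A\<^esub> x = \<zero>\<^bsub>?A\<^esub>" ..
next
  show "\<one>\<^bsub>presented_alg G R\<^esub> \<in> carrier (presented_alg G R)"
    "\<zero>\<^bsub>presented_alg G R\<^esub> \<in> carrier (presented_alg G R)"
    by (auto simp: presented_alg_carrier_iff presented_alg_one presented_alg_zero
        intro: exI[of _ 0] exI[of _ 1])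
qed


section \<open>Ore localization and tensor products\<close>

inductive_set mult_closure :: "('a, 'x) ring_scheme \<Rightarrow> 'a set \<Rightarrow> 'a set"
  for R :: "('a, 'x) ring_scheme" and B :: "'a set" where
  one: "\<one>\<^bsub>R\<^esub> \<in> mult_closure R B"
| mult: "s \<in> mult_closure R B \<Longrightarrow> b \<in> B \<Longrightarrow> s \<otimes>\<^bsub>R\<^esub> b \<in> mult_closure R B"

definition fractions ::
  "('a, 'x) ring_scheme \<Rightarrow> 'a set \<Rightarrow> ('b, 'y) ring_scheme \<Rightarrow> ('a \<Rightarrow> 'b) \<Rightarrow> 'b set"
  where "fractions R S Q \<iota> =
    {\<iota> r \<otimes>\<^bsub>Q\<^esub> inv\<^bsub>Q\<^esub> (\<iota> s) | r s. r \<in> carrier R \<and> s \<in> S}"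

text \<open>\<open>\<iota> : R \<rightarrow> Q\<close> is the localization of \<open>R\<close> at the multiplicative set \<open>S\<close>, as a ring of (right)
  fractions; this determines the pair \<open>(Q, \<iota>)\<close> up to unique isomorphism.\<close>

definition ore_localization ::
  "('a, 'x) ring_scheme \<Rightarrow> 'a set \<Rightarrow> ('b, 'y) ring_scheme \<Rightarrow> ('a \<Rightarrow> 'b) \<Rightarrow> bool"
  where "ore_localization R S Q \<iota> \<longleftrightarrow>
    ring Q \<and> \<iota> \<in> ring_hom R Q \<and>
    \<iota> ` S \<subseteq> Units Q \<and>
    carrier Q = fractions R S Q \<iota> \<and>
    (\<forall>r\<in>carrier R. \<iota> r = \<zero>\<^bsub>Q\<^esub> \<longleftrightarrow> (\<exists>s\<in>S. r \<otimes>\<^bsub>R\<^esub> s = \<zero>\<^bsub>R\<^esub>))"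

text \<open>Tensor product over the ground ring of two algebras \<open>A\<close>, \<open>B\<close> with structure maps \<open>\<alpha>\<close>, \<open>\<beta>\<close>: it is
  generated by the symbols \<open>a \<otimes> b\<close>, here \<open>Gen (a, b)\<close>, subject to bilinearity and
  \<open>(a \<otimes> b) (a' \<otimes> b') = a a' \<otimes> b b'\<close>.\<close>

inductive_set tensor_rels ::
  "('a, 'x) ring_scheme \<Rightarrow> ('k::comm_ring_1 \<Rightarrow> 'a) \<Rightarrow> ('b, 'y) ring_scheme \<Rightarrow> ('k \<Rightarrow> 'b)
     \<Rightarrow> (('k, 'a \<times> 'b) alg_term \<times> ('k, 'a \<times> 'b) alg_term) set"
  for A :: "('a, 'x) ring_scheme" and \<alpha> :: "'k::comm_ring_1 \<Rightarrow> 'a"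
    and B :: "('b, 'y) ring_scheme" and \<beta> :: "'k \<Rightarrow> 'b" where
  add_l: "\<lbrakk>a \<in> carrier A; a' \<in> carrier A; b \<in> carrier B\<rbrakk> \<Longrightarrow>
    (Gen (a \<oplus>\<^bsub>A\<^esub> a', b), Gen (a, b) + Gen (a', b)) \<in> tensor_rels A \<alpha> B \<beta>"
| add_r: "\<lbrakk>a \<in> carrier A; b \<in> carrier B; b' \<in> carrier B\<rbrakk> \<Longrightarrow>
    (Gen (a, b \<oplus>\<^bsub>B\<^esub> b'), Gen (a, b) + Gen (a, b')) \<in> tensor_rels A \<alpha> B \<beta>"
| scale_l: "\<lbrakk>a \<in> carrier A; b \<in> carrier B\<rbrakk> \<Longrightarrow>
    (Gen (\<alpha> c \<otimes>\<^bsub>A\<^esub> a, b), Const c * Gen (a, b)) \<in> tensor_rels A \<alpha> B \<beta>"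
| scale_r: "\<lbrakk>a \<in> carrier A; b \<in> carrier B\<rbrakk> \<Longrightarrow>
    (Gen (a, \<beta> c \<otimes>\<^bsub>B\<^esub> b), Const c * Gen (a, b)) \<in> tensor_rels A \<alpha> B \<beta>"
| mult: "\<lbrakk>a \<in> carrier A; a' \<in> carrier A; b \<in> carrier B; b' \<in> carrier B\<rbrakk> \<Longrightarrow>
    (Gen (a \<otimes>\<^bsub>A\<^esub> a', b \<otimes>\<^bsub>B\<^esub> b'), Gen (a, b) * Gen (a', b')) \<in> tensor_rels A \<alpha> B \<beta>"
| one: "(Gen (\<one>\<^bsub>A\<^esub>, \<one>\<^bsub>B\<^esub>), 1) \<in> tensor_rels A \<alpha> B \<beta>"

definition tensor_cls ::
  "('a, 'x) ring_scheme \<Rightarrow> ('k::comm_ring_1 \<Rightarrow> 'a) \<Rightarrow> ('b, 'y) ring_scheme \<Rightarrow> ('k \<Rightarrow> 'b)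
     \<Rightarrow> ('k, 'a \<times> 'b) alg_term \<Rightarrow> ('k, 'a \<times> 'b) alg_term set"
  where "tensor_cls A \<alpha> B \<beta> = alg_cls (carrier A \<times> carrier B) (tensor_rels A \<alpha> B \<beta>)"

definition tensor_alg ::
  "('a, 'x) ring_scheme \<Rightarrow> ('k::comm_ring_1 \<Rightarrow> 'a) \<Rightarrow> ('b, 'y) ring_scheme \<Rightarrow> ('k \<Rightarrow> 'b)
     \<Rightarrow> ('k, 'a \<times> 'b) alg_term set ring"
  where "tensor_alg A \<alpha> B \<beta> = presented_alg (carrier A \<times> carrier B) (tensor_rels A \<alpha> B \<beta>)"


section \<open>The ring of h-deformed differential operators\<close>

text \<open>\<open>HInv i j k\<close> is the inverse of \<open>h\<^sub>i - h\<^sub>j + k\<close>; adjoining these inverses to the polynomial ring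
  in the \<open>h\<^sub>i\<close> gives the localized ring of coefficients.\<close>

datatype diff_gen = HGen nat | HInv nat nat int | XGen nat | PGen nat

type_synonym 'k diff_term = "('k, diff_gen) alg_term"

abbreviation hh :: "nat \<Rightarrow> 'k diff_term" where "hh i \<equiv> Gen (HGen i)"
abbreviation hinv :: "nat \<Rightarrow> nat \<Rightarrow> int \<Rightarrow> 'k diff_term" where "hinv i j k \<equiv> Gen (HInv i j k)"
abbreviation xx :: "nat \<Rightarrow> 'k diff_term" where "xx j \<equiv> Gen (XGen j)"
abbreviation pp :: "nat \<Rightarrow> 'k diff_term" where "pp j \<equiv> Gen (PGen j)"

abbreviation hd2 :: "nat \<Rightarrow> nat \<Rightarrow> 'k::{zero,one} diff_term" where "hd2 i j \<equiv> hh i - hh j"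

abbreviation kron :: "nat \<Rightarrow> nat \<Rightarrow> ('k::{zero,one}, 'g) alg_term" where
  "kron i j \<equiv> (if i = j then 1 else 0)"

definition diff_gens :: "nat \<Rightarrow> diff_gen set" where
  "diff_gens n = HGen ` {1..n} \<union> {HInv i j k | i j k. i \<in> {1..n} \<and> j \<in> {1..n} \<and> i \<noteq> j}
     \<union> XGen ` {1..n} \<union> PGen ` {1..n}"

text \<open>The coefficient \<open>1 / (1 - h\<^sub>i\<^sub>j)\<close>; for \<open>i \<noteq> j\<close> note \<open>1 - h\<^sub>i\<^sub>j = h\<^sub>j\<^sub>i + 1\<close>.\<close>

definition inv_one_minus :: "nat \<Rightarrow> nat \<Rightarrow> 'k::{zero,one} diff_term" where
  "inv_one_minus i j = (if i = j then 1 else hinv j i 1)"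

inductive_set diff_rels :: "nat \<Rightarrow> ('k::comm_ring_1 diff_term \<times> 'k diff_term) set"
  for n :: nat where
  h_comm: "\<lbrakk>i \<in> {1..n}; j \<in> {1..n}\<rbrakk> \<Longrightarrow> (hh i * hh j, hh j * hh i) \<in> diff_rels n"
| inv_right: "\<lbrakk>i \<in> {1..n}; j \<in> {1..n}; i \<noteq> j\<rbrakk> \<Longrightarrow>
    ((hd2 i j + Const (of_int k)) * hinv i j k, 1) \<in> diff_rels n"
| inv_left: "\<lbrakk>i \<in> {1..n}; j \<in> {1..n}; i \<noteq> j\<rbrakk> \<Longrightarrow>
    (hinv i j k * (hd2 i j + Const (of_int k)), 1) \<in> diff_rels n"
| h_x: "\<lbrakk>i \<in> {1..n}; j \<in> {1..n}\<rbrakk> \<Longrightarrow>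
    (hh i * xx j, xx j * (hh i + kron i j)) \<in> diff_rels n"
| h_p: "\<lbrakk>i \<in> {1..n}; j \<in> {1..n}\<rbrakk> \<Longrightarrow>
    (hh i * pp j, pp j * (hh i - kron i j)) \<in> diff_rels n"
| x_x: "\<lbrakk>i \<in> {1..n}; j \<in> {1..n}; i < j\<rbrakk> \<Longrightarrow>
    (xx i * xx j, (hd2 i j + 1) * hinv i j 0 * (xx j * xx i)) \<in> diff_rels n"
| p_p: "\<lbrakk>i \<in> {1..n}; j \<in> {1..n}; i < j\<rbrakk> \<Longrightarrow>
    (pp i * pp j, (hd2 i j - 1) * hinv i j 0 * (pp j * pp i)) \<in> diff_rels n"
| x_p_less: "\<lbrakk>i \<in> {1..n}; j \<in> {1..n}; i < j\<rbrakk> \<Longrightarrow>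
    (xx i * pp j, pp j * xx i) \<in> diff_rels n"
| x_p_greater: "\<lbrakk>i \<in> {1..n}; j \<in> {1..n}; j < i\<rbrakk> \<Longrightarrow>
    (xx i * pp j,
      hd2 i j * (hd2 i j - Const 2) * (hinv i j (- 1) * hinv i j (- 1)) * (pp j * xx i))
      \<in> diff_rels n"
| x_p_eq: "i \<in> {1..n} \<Longrightarrow>
    (xx i * pp i,
      tsum (map (\<lambda>j. inv_one_minus i j * (pp j * xx j)) [1..<Suc n]) - 1) \<in> diff_rels n"

definition diff_cls :: "nat \<Rightarrow> 'k::comm_ring_1 diff_term \<Rightarrow> 'k diff_term set" where
  "diff_cls n = alg_cls (diff_gens n) (diff_rels n)"

definition Diff_h :: "nat \<Rightarrow> 'k::comm_ring_1 diff_term set ring" where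
  "Diff_h n = presented_alg (diff_gens n) (diff_rels n)"

definition S_x :: "nat \<Rightarrow> 'k::comm_ring_1 diff_term set set" where
  "S_x n = mult_closure (Diff_h n) ((\<lambda>j. diff_cls n (xx j)) ` {1..n})"

definition psi' :: "nat \<Rightarrow> 'k::{zero,one} diff_term" where
  "psi' i = tprod (map (\<lambda>k. hd2 i k) [1..<i])"

definition Gamma_elt :: "nat \<Rightarrow> 'k::{zero,one} diff_term" where
  "Gamma_elt j = pp j * xx j"

definition esym :: "nat \<Rightarrow> nat \<Rightarrow> 'k::{zero,one} diff_term" where
  "esym n k = tsum (map (\<lambda>js. tprod (map hh js))
                 (filter (\<lambda>js. length js = k) (subseqs [1..<Suc n])))"

text \<open>Formal partial derivative with respect to \<open>h\<^sub>j\<close>; only meant for polynomial expressions in the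
  \<open>h\<^sub>i\<close>.\<close>

primrec h_deriv :: "nat \<Rightarrow> 'k::{zero,one} diff_term \<Rightarrow> 'k diff_term" where
  "h_deriv j (Const c) = 0"
| "h_deriv j (Gen g) = (if g = HGen j then 1 else 0)"
| "h_deriv j (Plus s t) = h_deriv j s + h_deriv j t"
| "h_deriv j (Neg s) = - h_deriv j s"
| "h_deriv j (Times s t) = h_deriv j s * t + s * h_deriv j t"

definition c_elt :: "nat \<Rightarrow> nat \<Rightarrow> 'k::{zero,one} diff_term" where
  "c_elt n k = tsum (map (\<lambda>j. h_deriv j (esym n k) * Gamma_elt j) [1..<Suc n]) - esym n k"

text \<open>\<open>q\<close> is the \<open>i\<close>-th Zhelobenko automorphism; its values on the \<open>HInv\<close> generators are forced.\<close>

definition zhelobenko ::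
  "nat \<Rightarrow> nat \<Rightarrow> ('k::comm_ring_1 diff_term set \<Rightarrow> 'k diff_term set) \<Rightarrow> bool" where
  "zhelobenko n i q \<longleftrightarrow>
    q \<in> ring_iso (Diff_h n) (Diff_h n) \<and>
    (\<forall>c. q (diff_cls n (Const c)) = diff_cls n (Const c)) \<and>
    q (diff_cls n (xx i)) =
      diff_cls n (- (xx (i + 1) * (hd2 i (i + 1) * hinv i (i + 1) (- 1)))) \<and>
    q (diff_cls n (xx (i + 1))) = diff_cls n (xx i) \<and>
    (\<forall>j\<in>{1..n} - {i, i + 1}. q (diff_cls n (xx j)) = diff_cls n (xx j)) \<and>
    q (diff_cls n (pp i)) =
      diff_cls n (- ((hd2 i (i + 1) - 1) * hinv i (i + 1) 0 * pp (i + 1))) \<and>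
    q (diff_cls n (pp (i + 1))) = diff_cls n (pp i) \<and>
    (\<forall>j\<in>{1..n} - {i, i + 1}. q (diff_cls n (pp j)) = diff_cls n (pp j)) \<and>
    (\<forall>j\<in>{1..n}. q (diff_cls n (hh j)) = diff_cls n (hh (Transposition.transpose i (i + 1) j)))"

text \<open>The \<open>q i\<close>, \<open>1 \<le> i < n\<close>, define an action of the braid group on \<open>n\<close> strands by automorphisms of
  the algebra \<open>R\<close> with structure map \<open>\<kappa>\<close>.\<close>

definition braid_action ::
  "nat \<Rightarrow> ('a, 'x) ring_scheme \<Rightarrow> ('k \<Rightarrow> 'a) \<Rightarrow> (nat \<Rightarrow> 'a \<Rightarrow> 'a) \<Rightarrow> bool" where
  "braid_action n R \<kappa> q \<longleftrightarrow>
    (\<forall>i\<in>{1..<n}. q i \<in> ring_iso R R \<and> (\<forall>c. q i (\<kappa> c) = \<kappa> c)) \<and>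
    (\<forall>i\<in>{1..<n}. \<forall>j\<in>{1..<n}. i + 1 < j \<longrightarrow>
       (\<forall>r\<in>carrier R. q i (q j r) = q j (q i r))) \<and>
    (\<forall>i. 1 \<le> i \<and> i + 1 < n \<longrightarrow>
       (\<forall>r\<in>carrier R. q i (q (i + 1) (q i r)) = q (i + 1) (q i (q (i + 1) r))))"


section \<open>The Weyl algebra\<close>

datatype weyl_gen = WXGen nat | WDGen nat

type_synonym 'k weyl_term = "('k, weyl_gen) alg_term"

abbreviation wX :: "nat \<Rightarrow> 'k weyl_term" where "wX j \<equiv> Gen (WXGen j)"
abbreviation wD :: "nat \<Rightarrow> 'k weyl_term" where "wD j \<equiv> Gen (WDGen j)"

definition weyl_gens :: "nat \<Rightarrow> weyl_gen set" where
  "weyl_gens n = WXGen ` {1..n} \<union> WDGen ` {1..n}"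

inductive_set weyl_rels :: "nat \<Rightarrow> ('k::comm_ring_1 weyl_term \<times> 'k weyl_term) set"
  for n :: nat where
  X_X: "\<lbrakk>i \<in> {1..n}; j \<in> {1..n}\<rbrakk> \<Longrightarrow> (wX i * wX j, wX j * wX i) \<in> weyl_rels n"
| D_D: "\<lbrakk>i \<in> {1..n}; j \<in> {1..n}\<rbrakk> \<Longrightarrow> (wD i * wD j, wD j * wD i) \<in> weyl_rels n"
| D_X: "\<lbrakk>i \<in> {1..n}; j \<in> {1..n}\<rbrakk> \<Longrightarrow>
    (wD i * wX j, kron i j + wX j * wD i) \<in> weyl_rels n"

definition weyl_cls :: "nat \<Rightarrow> 'k::comm_ring_1 weyl_term \<Rightarrow> 'k weyl_term set" where
  "weyl_cls n = alg_cls (weyl_gens n) (weyl_rels n)"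

definition Weyl :: "nat \<Rightarrow> 'k::comm_ring_1 weyl_term set ring" where
  "Weyl n = presented_alg (weyl_gens n) (weyl_rels n)"

definition wH :: "nat \<Rightarrow> 'k::{zero,one} weyl_term" where "wH j = wD j * wX j"

definition T0_gens :: "nat \<Rightarrow> 'k::comm_ring_1 weyl_term set set" where
  "T0_gens n = {weyl_cls n (wX j * wD j - wX k * wD k + Const (of_int l)) | j k l.
                  1 \<le> j \<and> j < k \<and> k \<le> n}"

definition T0_set :: "nat \<Rightarrow> 'k::comm_ring_1 weyl_term set set" where
  "T0_set n = mult_closure (Weyl n) (T0_gens n)"

definition T_set :: "nat \<Rightarrow> 'k::comm_ring_1 weyl_term set set" where
  "T_set n = mult_closure (Weyl n) (T0_gens n \<union> (\<lambda>j. weyl_cls n (wX j)) ` {1..n})"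


section \<open>Polynomials over the localized Weyl algebra\<close>

text \<open>The commutative polynomial ring in the indeterminates \<open>a\<^sub>1, \<dots>, a\<^sub>n\<close>.\<close>

inductive_set poly_rels :: "nat \<Rightarrow> (('k::comm_ring_1, nat) alg_term \<times> ('k, nat) alg_term) set"
  for n :: nat where
  "\<lbrakk>i \<in> {1..n}; j \<in> {1..n}\<rbrakk> \<Longrightarrow> (Gen i * Gen j, Gen j * Gen i) \<in> poly_rels n"

definition poly_cls :: "nat \<Rightarrow> ('k::comm_ring_1, nat) alg_term \<Rightarrow> ('k, nat) alg_term set" where
  "poly_cls n = alg_cls {1..n} (poly_rels n)"

definition Poly :: "nat \<Rightarrow> ('k::comm_ring_1, nat) alg_term set ring" where
  "Poly n = presented_alg {1..n} (poly_rels n)"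

type_synonym ('k, 'l) pw = "('k, ('k, nat) alg_term set \<times> 'l) alg_term set"

text \<open>Here \<open>L\<close> with \<open>\<iota>\<close> is a localization of the Weyl algebra, and its ground ring structure is
  inherited along \<open>\<iota>\<close>.\<close>

definition PW :: "nat \<Rightarrow> ('l, 'x) ring_scheme \<Rightarrow> ('k::comm_ring_1 weyl_term set \<Rightarrow> 'l)
    \<Rightarrow> ('k, 'l) pw ring" where
  "PW n L \<iota> = tensor_alg (Poly n) (\<lambda>c. poly_cls n (Const c)) L (\<lambda>c. \<iota> (weyl_cls n (Const c)))"

definition PW_cls :: "nat \<Rightarrow> ('l, 'x) ring_scheme \<Rightarrow> ('k::comm_ring_1 weyl_term set \<Rightarrow> 'l)
    \<Rightarrow> ('k, ('k, nat) alg_term set \<times> 'l) alg_term \<Rightarrow> ('k, 'l) pw" where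
  "PW_cls n L \<iota> = tensor_cls (Poly n) (\<lambda>c. poly_cls n (Const c)) L (\<lambda>c. \<iota> (weyl_cls n (Const c)))"

definition PW_a :: "nat \<Rightarrow> ('l, 'x) ring_scheme \<Rightarrow> ('k::comm_ring_1 weyl_term set \<Rightarrow> 'l)
    \<Rightarrow> nat \<Rightarrow> ('k, 'l) pw" where
  "PW_a n L \<iota> i = PW_cls n L \<iota> (Gen (poly_cls n (Gen i), \<one>\<^bsub>L\<^esub>))"

definition PW_emb :: "nat \<Rightarrow> ('l, 'x) ring_scheme \<Rightarrow> ('k::comm_ring_1 weyl_term set \<Rightarrow> 'l)
    \<Rightarrow> 'l \<Rightarrow> ('k, 'l) pw" where
  "PW_emb n L \<iota> w = PW_cls n L \<iota> (Gen (\<one>\<^bsub>Poly n\<^esub>, w))"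

definition PW_weyl :: "nat \<Rightarrow> ('l, 'x) ring_scheme \<Rightarrow> ('k::comm_ring_1 weyl_term set \<Rightarrow> 'l)
    \<Rightarrow> 'k weyl_term \<Rightarrow> ('k, 'l) pw" where
  "PW_weyl n L \<iota> t = PW_emb n L \<iota> (\<iota> (weyl_cls n t))"

text \<open>\<open>\<mu>\<close> is the isomorphism of algebras over the ground ring determined by \<open>X\<^sup>i \<mapsto> x\<^sup>i \<psi>\<^sub>i'\<close>,
  \<open>\<H>\<^sub>i \<mapsto> h\<^sub>i\<close>, \<open>a\<^sub>i \<mapsto> c\<^sub>i\<close>; here \<open>(L, l)\<close> and \<open>(Q, \<iota>)\<close> are the localizations of the Weyl algebra and
  of the ring of h-deformed differential operators.\<close>

definition is_mu ::
  "nat \<Rightarrow> ('l, 'x) ring_scheme \<Rightarrow> ('k::comm_ring_1 weyl_term set \<Rightarrow> 'l)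
     \<Rightarrow> ('q, 'y) ring_scheme \<Rightarrow> ('k diff_term set \<Rightarrow> 'q) \<Rightarrow> (('k, 'l) pw \<Rightarrow> 'q) \<Rightarrow> bool" where
  "is_mu n L l Q \<iota> \<mu> \<longleftrightarrow>
    \<mu> \<in> ring_iso (PW n L l) Q \<and>
    (\<forall>c. \<mu> (PW_cls n L l (Const c)) = \<iota> (diff_cls n (Const c))) \<and>
    (\<forall>i\<in>{1..n}. \<mu> (PW_weyl n L l (wX i)) = \<iota> (diff_cls n (xx i * psi' i))) \<and>
    (\<forall>i\<in>{1..n}. \<mu> (PW_weyl n L l (wH i)) = \<iota> (diff_cls n (hh i))) \<and>
    (\<forall>i\<in>{1..n}. \<mu> (PW_a n L l i) = \<iota> (diff_cls n (c_elt n i)))"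

definition transport :: "('p, 'x) ring_scheme \<Rightarrow> ('p \<Rightarrow> 'q) \<Rightarrow> ('q \<Rightarrow> 'q) \<Rightarrow> 'p \<Rightarrow> 'p" where
  "transport P \<mu> f = inv_into (carrier P) \<mu> \<circ> f \<circ> \<mu>"

end

theory Submission
  imports Defs
begin

text \<open>Why the formulas hold. The elements \<open>x\<^sup>i \<psi>\<^sub>i'\<close> are normalized so that the Zhelobenko automorphism acts on
  them by a single factor. It turns \<open>\<psi>\<^sub>i' = \<Prod>\<^sub>k\<^sub><\<^sub>i h\<^sub>i\<^sub>k\<close> into \<open>\<Prod>\<^sub>k\<^sub><\<^sub>i h\<^sub>i\<^sub>+\<^sub>1\<^sub>,\<^sub>k\<close>, which is \<open>\<psi>'\<^sub>i\<^sub>+\<^sub>1\<close> without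
  its last factor \<open>- h\<^sub>i\<^sub>,\<^sub>i\<^sub>+\<^sub>1\<close>, and that factor cancels the numerator of the coefficient
  \<open>- h\<^sub>i\<^sub>,\<^sub>i\<^sub>+\<^sub>1 / (h\<^sub>i\<^sub>,\<^sub>i\<^sub>+\<^sub>1 - 1)\<close>; what remains becomes \<open>1 / h\<^sub>i\<^sub>,\<^sub>i\<^sub>+\<^sub>1\<close> when it is moved to the left of \<open>x\<^sup>i\<^sup>+\<^sup>1\<close>
  (\<open>q_x_psi'_lower\<close>, \<open>q_x_psi'_upper\<close>, \<open>q_x_psi'_other\<close>). Along \<open>\<mu>\<close> these are the formulas for the
  \<open>X\<^sup>j\<close>, and \<open>\<H>\<^sub>j\<close> goes to \<open>\<H>\<close> with transposed index. The formulas for \<open>D\<^sub>j\<close> need no further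
  computation in the ring of differential operators: the relation \<open>D\<^sub>j X\<^sup>j = \<H>\<^sub>j\<close> and the
  invertibility of \<open>X\<^sup>j\<close> determine the image of \<open>D\<^sub>j\<close> (\<open>\<sigma>_D_eqI\<close>).

  Why the subrings are preserved. Each of them is generated by the ground ring, the \<open>X\<^sup>j\<close> and \<open>D\<^sub>j\<close>,
  and the inverses of the generators of the denominator set. The automorphism permutes the denominators
  \<open>\<H>\<^sub>j - \<H>\<^sub>k + c\<close> up to sign, and it permutes the \<open>X\<^sup>j\<close> and the \<open>D\<^sub>j\<close> up to such denominators;
  so both the image and the preimage of the subring contain all generators (\<open>image_fractions\<close>). For the
  denominator set without the \<open>X\<^sup>j\<close> one also has to know that the fractions form a ring. This is the Ore
  condition (\<open>T0_ore\<close>), valid because moving \<open>\<H>\<^sub>j - \<H>\<^sub>k + c\<close> past a generator of the Weyl algebra only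
  shifts \<open>c\<close>.

  The braid relations pass from the ring of differential operators to its localization, since a ring
  homomorphism on a ring of fractions is determined by the numerators (\<open>ring_hom_fractions_eq\<close>), and then
  along \<open>\<mu>\<close>.\<close>


section \<open>Presented algebras\<close>

lemma presented_alg_closed:
  "alg_gens t \<subseteq> G \<Longrightarrow> alg_cls G R t \<in> carrier (presented_alg G R)"
  by (auto simp: presented_alg_carrier_iff)

lemma presented_alg_neg:
  assumes "alg_gens t \<subseteq> G"
  shows "\<ominus>\<^bsub>presented_alg G R\<^esub> alg_cls G R t = alg_cls G R (- t)"
proof -
  interpret ring "presented_alg G R" by (rule presented_alg_ring)
  have "alg_cls G R (- t) \<oplus>\<^bsub>presented_alg G R\<^esub> alg_cls G R t = \<zero>\<^bsub>presented_alg G R\<^esub>"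
    using assms by (simp add: presented_alg_add presented_alg_zero alg_cls_eqI[OF alg_eq.plus_neg])
  then show ?thesis
    using assms minus_equality by (simp add: presented_alg_closed)
qed

lemma presented_alg_diff:
  assumes "alg_gens s \<subseteq> G" "alg_gens t \<subseteq> G"
  shows "alg_cls G R s \<ominus>\<^bsub>presented_alg G R\<^esub> alg_cls G R t = alg_cls G R (s - t)"
  using assms
  by (simp add: a_minus_def presented_alg_neg presented_alg_add)
    (simp add: alg_term_syntax)

lemma presented_alg_const_central:
  "alg_gens t \<subseteq> G \<Longrightarrow>
    alg_cls G R (Const a) \<otimes>\<^bsub>presented_alg G R\<^esub> alg_cls G R t
      = alg_cls G R t \<otimes>\<^bsub>presented_alg G R\<^esub> alg_cls G R (Const a)"
  by (simp add: presented_alg_mult alg_cls_eqI[OF alg_eq.const_central])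

lemma alg_cls_const_add:
  "alg_cls G R (Const (a + b)) = alg_cls G R (Const a) \<oplus>\<^bsub>presented_alg G R\<^esub> alg_cls G R (Const b)"
  by (simp add: presented_alg_add alg_cls_eqI[OF alg_eq.const_plus])

lemma alg_cls_const_zero: "alg_cls G R (Const 0) = \<zero>\<^bsub>presented_alg G R\<^esub>"
  and alg_cls_const_one: "alg_cls G R (Const 1) = \<one>\<^bsub>presented_alg G R\<^esub>"
  by (simp_all add: presented_alg_zero presented_alg_one alg_term_syntax)

lemma alg_cls_const_minus:
  "alg_cls G R (Const (- a)) = \<ominus>\<^bsub>presented_alg G R\<^esub> alg_cls G R (Const a)"
proof -
  interpret ring "presented_alg G R" by (rule presented_alg_ring)
  have "alg_cls G R (Const (- a)) \<oplus>\<^bsub>presented_alg G R\<^esub> alg_cls G R (Const a)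
      = \<zero>\<^bsub>presented_alg G R\<^esub>"
    by (simp flip: alg_cls_const_add alg_cls_const_zero)
  then show ?thesis
    by (simp add: minus_equality presented_alg_closed)
qed

lemma presented_alg_induct [consumes 1, case_names const gen plus neg times]:
  assumes x: "x \<in> carrier (presented_alg G R)"
    and "\<And>c. Pr (alg_cls G R (Const c))"
    and "\<And>g. g \<in> G \<Longrightarrow> Pr (alg_cls G R (Gen g))"
    and "\<And>x y. \<lbrakk>x \<in> carrier (presented_alg G R); y \<in> carrier (presented_alg G R); Pr x; Pr y\<rbrakk>
      \<Longrightarrow> Pr (x \<oplus>\<^bsub>presented_alg G R\<^esub> y)"
    and "\<And>x. \<lbrakk>x \<in> carrier (presented_alg G R); Pr x\<rbrakk> \<Longrightarrow> Pr (\<ominus>\<^bsub>presented_alg G R\<^esub> x)"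
    and "\<And>x y. \<lbrakk>x \<in> carrier (presented_alg G R); y \<in> carrier (presented_alg G R); Pr x; Pr y\<rbrakk>
      \<Longrightarrow> Pr (x \<otimes>\<^bsub>presented_alg G R\<^esub> y)"
  shows "Pr x"
proof -
  obtain t where t: "alg_gens t \<subseteq> G" "x = alg_cls G R t"
    using x by (auto simp: presented_alg_carrier_iff)
  have "alg_gens t \<subseteq> G \<Longrightarrow> Pr (alg_cls G R t)"
  proof (induction t)
    case (Plus s t)
    then show ?case
      using assms(4)[of "alg_cls G R s" "alg_cls G R t"]
      by (simp add: presented_alg_add presented_alg_closed) (simp add: alg_term_syntax)
  next
    case (Neg t)
    then show ?case
      using assms(5)[of "alg_cls G R t"]
      by (simp add: presented_alg_neg presented_alg_closed) (simp add: alg_term_syntax)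
  next
    case (Times s t)
    then show ?case
      using assms(6)[of "alg_cls G R s" "alg_cls G R t"]
      by (simp add: presented_alg_mult presented_alg_closed) (simp add: alg_term_syntax)
  qed (use assms(2,3) in auto)
  with t show ?thesis by simp
qed

lemma presented_alg_hom_into_subring:
  assumes P: "ring P" and f: "f \<in> ring_hom (presented_alg G R) P" and K: "subring K P"
    and const: "\<And>c. f (alg_cls G R (Const c)) \<in> K"
    and gen: "\<And>g. g \<in> G \<Longrightarrow> f (alg_cls G R (Gen g)) \<in> K"
    and x: "x \<in> carrier (presented_alg G R)"
  shows "f x \<in> K"
proof -
  interpret f: ring_hom_ring "presented_alg G R" P f
    by (intro ring_hom_ringI2 presented_alg_ring P f)
  note K = subringE[OF K]
  show ?thesis
    using x by (induction rule: presented_alg_induct) (auto simp: const gen K(5-7))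
qed


section \<open>Rings of fractions\<close>

lemma ring_hom_Units:
  assumes "f \<in> ring_hom R S" "x \<in> Units R"
  shows "f x \<in> Units S"
proof -
  obtain y where "x \<in> carrier R" "y \<in> carrier R" "y \<otimes>\<^bsub>R\<^esub> x = \<one>\<^bsub>R\<^esub>" "x \<otimes>\<^bsub>R\<^esub> y = \<one>\<^bsub>R\<^esub>"
    using assms(2) by (auto simp: Units_def)
  then show ?thesis
    using assms(1) unfolding Units_def
    by (smt (verit) mem_Collect_eq ring_hom_closed ring_hom_mult ring_hom_one)
qed

lemma ring_hom_inv:
  assumes "f \<in> ring_hom R S" "x \<in> Units R" "ring R" "ring S"
  shows "f (inv\<^bsub>R\<^esub> x) = inv\<^bsub>S\<^esub> f x"
proof -
  interpret R: ring R by fact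
  interpret S: ring S by fact
  have "f x \<otimes>\<^bsub>S\<^esub> f (inv\<^bsub>R\<^esub> x) = \<one>\<^bsub>S\<^esub>"
    using assms(1,2) by (metis R.Units_closed R.Units_inv_closed R.Units_r_inv ring_hom_mult ring_hom_one)
  moreover have "f x \<in> Units S" using assms(1,2) by (rule ring_hom_Units)
  moreover have "f (inv\<^bsub>R\<^esub> x) \<in> carrier S"
    using assms(1,2) by (auto intro: ring_hom_closed)
  ultimately show ?thesis
    by (metis S.Units_closed S.Units_inv_closed S.Units_l_inv S.inv_unique)
qed

lemma mult_closure_closed:
  assumes "ring R" "B \<subseteq> carrier R"
  shows "mult_closure R B \<subseteq> carrier R"
proof
  interpret ring R by fact
  fix s assume "s \<in> mult_closure R B"
  then show "s \<in> carrier R" by induction (use assms(2) in auto)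
qed

lemma mult_closure_mult:
  assumes "ring R" "B \<subseteq> carrier R" "s \<in> mult_closure R B" "t \<in> mult_closure R B"
  shows "s \<otimes>\<^bsub>R\<^esub> t \<in> mult_closure R B"
proof -
  interpret ring R by fact
  note [simp] = subsetD[OF mult_closure_closed[OF assms(1,2)]] subsetD[OF assms(2)]
  show ?thesis
    using assms(4)
  proof induction
    case (mult t b)
    then have "s \<otimes>\<^bsub>R\<^esub> (t \<otimes>\<^bsub>R\<^esub> b) = (s \<otimes>\<^bsub>R\<^esub> t) \<otimes>\<^bsub>R\<^esub> b"
      using assms(3) by (simp add: m_assoc)
    with mult show ?case by (simp add: mult_closure.mult)
  qed (use assms(3) in simp)
qed

lemma mult_closure_incl:
  assumes "ring R" "B \<subseteq> carrier R" "b \<in> B"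
  shows "b \<in> mult_closure R B"
proof -
  interpret ring R by fact
  have "\<one>\<^bsub>R\<^esub> \<otimes>\<^bsub>R\<^esub> b \<in> mult_closure R B"
    using assms(3) by (intro mult_closure.intros)
  with assms(2,3) show ?thesis by auto
qed

text \<open>Units are taken inside a subring \<open>K\<close>, so that the conclusion says that the inverse of \<open>f s\<close> lies in
  \<open>K\<close>; taking \<open>K = carrier P\<close> recovers the plain statement.\<close>

lemma mult_closure_hom_Units:
  assumes "ring R" "ring P" "f \<in> ring_hom R P" "B \<subseteq> carrier R"
    and K: "subring K P" "\<And>b. b \<in> B \<Longrightarrow> f b \<in> Units (P\<lparr>carrier := K\<rparr>)"
    and s: "s \<in> mult_closure R B"
  shows "f s \<in> Units (P\<lparr>carrier := K\<rparr>)"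
proof -
  interpret P: ring P by fact
  interpret PK: ring "P\<lparr>carrier := K\<rparr>" using K(1) by (rule P.subring_is_ring)
  show ?thesis
    using s
  proof induction
    case one
    then show ?case using PK.Units_one_closed assms(3) by (simp add: ring_hom_one)
  next
    case (mult s b)
    then have "f (s \<otimes>\<^bsub>R\<^esub> b) = f s \<otimes>\<^bsub>P\<^esub> f b"
      using assms(3,4) mult_closure_closed[OF assms(1,4)] by (intro ring_hom_mult) auto
    with mult K(2) PK.Units_m_closed[of "f s" "f b"] show ?case by simp
  qed
qed

lemma Units_subring_inv:
  assumes "ring P" "subring K P" "x \<in> Units (P\<lparr>carrier := K\<rparr>)"
  shows "x \<in> Units P" "inv\<^bsub>P\<^esub> x \<in> K"
proof -
  interpret P: ring P by fact
  interpret PK: ring "P\<lparr>carrier := K\<rparr>" using assms(2) by (rule P.subring_is_ring)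
  show "x \<in> Units P"
    using assms(3) subringE(1)[OF assms(2)] by (auto simp: Units_def)
  show "inv\<^bsub>P\<^esub> x \<in> K"
    using P.m_inv_monoid_consistent[OF assms(3) subring.axioms(2)[OF assms(2)]]
      PK.Units_inv_closed[OF assms(3)] by simp
qed

lemma (in ring) neg_one_Units_subring:
  assumes "subring K R"
  shows "\<ominus> \<one> \<in> Units (R\<lparr>carrier := K\<rparr>)"
  using subringE(3,5)[OF assms]
  by (auto simp: Units_def l_minus r_minus intro!: bexI[of _ "\<ominus> \<one>"])

lemma fractions_units:
  assumes "ring R" "ring P" "f \<in> ring_hom R P" "B \<subseteq> carrier R" "f ` mult_closure R B \<subseteq> Units P"
  defines "F \<equiv> fractions R (mult_closure R B) P f"
  shows "r \<in> carrier R \<Longrightarrow> f r \<in> F"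
    and "s \<in> mult_closure R B \<Longrightarrow> f s \<in> Units (P\<lparr>carrier := F\<rparr>)"
proof -
  interpret R: ring R by fact
  interpret P: ring P by fact
  have one: "f \<one>\<^bsub>R\<^esub> = \<one>\<^bsub>P\<^esub>" using assms(3) by (rule ring_hom_one)
  show incl: "f r \<in> F" if "r \<in> carrier R" for r
  proof -
    have "f r = f r \<otimes>\<^bsub>P\<^esub> inv\<^bsub>P\<^esub> (f \<one>\<^bsub>R\<^esub>)"
      using that assms(3) by (simp add: one ring_hom_closed)
    with that show ?thesis unfolding F_def fractions_def by (blast intro: mult_closure.one)
  qed
  show "f s \<in> Units (P\<lparr>carrier := F\<rparr>)" if s: "s \<in> mult_closure R B"
  proof -
    have u: "f s \<in> Units P" using s assms(5) by auto
    then have "inv\<^bsub>P\<^esub> f s = f \<one>\<^bsub>R\<^esub> \<otimes>\<^bsub>P\<^esub> inv\<^bsub>P\<^esub> f s" by (simp add: one)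
    with s have "inv\<^bsub>P\<^esub> f s \<in> F" unfolding F_def fractions_def by blast
    moreover have "f s \<in> F"
      using s mult_closure_closed[OF assms(1,4)] by (intro incl) auto
    ultimately show ?thesis using u
      by (auto simp: Units_def[of "P\<lparr>carrier := F\<rparr>"] intro!: bexI[of _ "inv\<^bsub>P\<^esub> f s"])
  qed
qed

text \<open>A ring of fractions is the smallest subring that contains the generators and in which the generating
  denominators are invertible. Containment in a subring is thereby reduced to finitely many kinds of
  elements.\<close>

lemma fractions_subset:
  assumes "ring P" "f \<in> ring_hom (presented_alg G R) P" "B \<subseteq> carrier (presented_alg G R)"
    and K: "subring K P"
    and const: "\<And>c. f (alg_cls G R (Const c)) \<in> K"
    and gen: "\<And>g. g \<in> G \<Longrightarrow> f (alg_cls G R (Gen g)) \<in> K"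
    and unit: "\<And>b. b \<in> B \<Longrightarrow> f b \<in> Units (P\<lparr>carrier := K\<rparr>)"
  shows "fractions (presented_alg G R) (mult_closure (presented_alg G R) B) P f \<subseteq> K"
proof -
  have "f r \<in> K" if "r \<in> carrier (presented_alg G R)" for r
    using presented_alg_hom_into_subring[OF assms(1,2) K const gen that] .
  moreover have "inv\<^bsub>P\<^esub> f s \<in> K" if "s \<in> mult_closure (presented_alg G R) B" for s
    using mult_closure_hom_Units[OF presented_alg_ring assms(1-3) K unit that]
    by (intro Units_subring_inv[OF assms(1) K])
  ultimately show ?thesis
    by (auto simp: fractions_def intro: subringE(6)[OF K])
qed

lemma fractions_image:
  assumes "ring Q" "ring P" "f \<in> ring_hom Q P" "g \<in> ring_hom R Q" "g ` S \<subseteq> Units Q"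
    "S \<subseteq> carrier R"
  shows "f ` fractions R S Q g = fractions R S P (f \<circ> g)"
proof -
  interpret Q: ring Q by fact
  have "f (g r \<otimes>\<^bsub>Q\<^esub> inv\<^bsub>Q\<^esub> g s) = f (g r) \<otimes>\<^bsub>P\<^esub> inv\<^bsub>P\<^esub> f (g s)" if "r \<in> carrier R" "s \<in> S" for r s
  proof -
    have "g s \<in> Units Q" "g r \<in> carrier Q" using assms that by (auto intro: ring_hom_closed)
    then show ?thesis using assms by (simp add: ring_hom_mult ring_hom_inv)
  qed
  then show ?thesis
    unfolding fractions_def by (auto simp: image_iff) metis+
qed

lemma ring_hom_fractions_eq:
  assumes rings: "ring Q" "ring Q'" and hom: "f \<in> ring_hom Q Q'" "g \<in> ring_hom Q Q'"
    and "\<iota> \<in> ring_hom R Q" "\<iota> ` S \<subseteq> Units Q" "S \<subseteq> carrier R"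
    and eq: "\<And>r. r \<in> carrier R \<Longrightarrow> f (\<iota> r) = g (\<iota> r)"
    and z: "z \<in> fractions R S Q \<iota>"
  shows "f z = g z"
proof -
  interpret Q: ring Q by fact
  obtain r s where "r \<in> carrier R" "s \<in> S" and z: "z = \<iota> r \<otimes>\<^bsub>Q\<^esub> inv\<^bsub>Q\<^esub> \<iota> s"
    using z by (auto simp: fractions_def)
  then have "\<iota> r \<in> carrier Q" "\<iota> s \<in> Units Q" "f (\<iota> r) = g (\<iota> r)" "f (\<iota> s) = g (\<iota> s)"
    using assms(5-8) by (auto intro: ring_hom_closed)
  then show ?thesis
    unfolding z using hom rings by (simp add: ring_hom_mult ring_hom_inv)
qed

text \<open>The Ore condition is used twice: it rewrites \<open>s\<inverse> r'\<close> as a right fraction, which gives products, and it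
  provides common denominators, which gives sums.\<close>

lemma fractions_subring:
  assumes "ring R" "ring P" "f \<in> ring_hom R P" "S \<subseteq> carrier R" "f ` S \<subseteq> Units P"
    and one: "\<one>\<^bsub>R\<^esub> \<in> S" and mult: "\<And>s t. s \<in> S \<Longrightarrow> t \<in> S \<Longrightarrow> s \<otimes>\<^bsub>R\<^esub> t \<in> S"
    and ore: "\<And>r s. r \<in> carrier R \<Longrightarrow> s \<in> S \<Longrightarrow>
      \<exists>r'\<in>carrier R. \<exists>s'\<in>S. r \<otimes>\<^bsub>R\<^esub> s' = s \<otimes>\<^bsub>R\<^esub> r'"
  shows "subring (fractions R S P f) P"
proof -
  interpret R: ring R by fact
  interpret P: ring P by fact
  interpret f: ring_hom_ring R P f by (intro ring_hom_ringI2 assms)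
  have U [simp]: "f s \<in> Units P" if "s \<in> S" for s using assms(5) that by auto
  have S [simp]: "s \<in> carrier R" if "s \<in> S" for s using assms(4) that by auto
  have frac_eq: "y = f r \<otimes>\<^bsub>P\<^esub> inv\<^bsub>P\<^esub> f s \<longleftrightarrow> y \<otimes>\<^bsub>P\<^esub> f s = f r"
    if "r \<in> carrier R" "s \<in> S" "y \<in> carrier P" for y r s
    using that by (metis P.Units_closed P.Units_inv_closed P.Units_l_inv P.Units_r_inv P.m_assoc
        P.r_one U f.hom_closed)
  have mem: "y \<in> fractions R S P f \<longleftrightarrow>
      y \<in> carrier P \<and> (\<exists>r\<in>carrier R. \<exists>s\<in>S. y \<otimes>\<^bsub>P\<^esub> f s = f r)" for y
  proof -
    have "f r \<otimes>\<^bsub>P\<^esub> inv\<^bsub>P\<^esub> f s \<in> carrier P" if "r \<in> carrier R" "s \<in> S" for r s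
      using that by auto
    then show ?thesis unfolding fractions_def using frac_eq by (auto; metis)
  qed
  show ?thesis
  proof (rule P.subringI)
    show "fractions R S P f \<subseteq> carrier P" by (auto simp: mem)
    show "\<one>\<^bsub>P\<^esub> \<in> fractions R S P f"
      unfolding mem using one by (auto intro!: bexI[of _ "\<one>\<^bsub>R\<^esub>"])
  next
    fix y assume "y \<in> fractions R S P f"
    then obtain r s where *: "y \<in> carrier P" "r \<in> carrier R" "s \<in> S" "y \<otimes>\<^bsub>P\<^esub> f s = f r"
      by (auto simp: mem)
    then have "(\<ominus>\<^bsub>P\<^esub> y) \<otimes>\<^bsub>P\<^esub> f s = f (\<ominus>\<^bsub>R\<^esub> r)" by (simp add: P.l_minus)
    with * show "\<ominus>\<^bsub>P\<^esub> y \<in> fractions R S P f"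
      unfolding mem by (meson P.add.inv_closed R.add.inv_closed)
  next
    fix y z assume "y \<in> fractions R S P f" "z \<in> fractions R S P f"
    then obtain r s r' s' where y: "y \<in> carrier P" "r \<in> carrier R" "s \<in> S" "y \<otimes>\<^bsub>P\<^esub> f s = f r"
      and z: "z \<in> carrier P" "r' \<in> carrier R" "s' \<in> S" "z \<otimes>\<^bsub>P\<^esub> f s' = f r'"
      by (auto simp: mem)
    \<comment> \<open>\<open>s\<inverse> r' = u t\<inverse>\<close> brings \<open>y z = r s\<inverse> r' s'\<inverse>\<close> to the form \<open>(r u) (s' t)\<inverse>\<close>\<close>
    obtain u t where u: "u \<in> carrier R" "t \<in> S" "r' \<otimes>\<^bsub>R\<^esub> t = s \<otimes>\<^bsub>R\<^esub> u"
      using ore[OF z(2) y(3)] by auto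
    have "(y \<otimes>\<^bsub>P\<^esub> z) \<otimes>\<^bsub>P\<^esub> f (s' \<otimes>\<^bsub>R\<^esub> t) = y \<otimes>\<^bsub>P\<^esub> ((z \<otimes>\<^bsub>P\<^esub> f s') \<otimes>\<^bsub>P\<^esub> f t)"
      using y(1) z(1,3) u(2) by (simp add: P.m_assoc)
    also have "\<dots> = y \<otimes>\<^bsub>P\<^esub> f (s \<otimes>\<^bsub>R\<^esub> u)" using z u by (simp only: z(4) f.hom_mult S flip: u(3))
    also have "\<dots> = f (r \<otimes>\<^bsub>R\<^esub> u)" using y u by (simp flip: P.m_assoc)
    finally show "y \<otimes>\<^bsub>P\<^esub> z \<in> fractions R S P f"
      unfolding mem using y(1,2) z(1,3) u(1,2) mult by (meson P.m_closed R.m_closed)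
    obtain v a where v: "v \<in> carrier R" "a \<in> S" "s \<otimes>\<^bsub>R\<^esub> a = s' \<otimes>\<^bsub>R\<^esub> v"
      using ore[of s s'] y z by auto
    have "z \<otimes>\<^bsub>P\<^esub> f (s \<otimes>\<^bsub>R\<^esub> a) = f (r' \<otimes>\<^bsub>R\<^esub> v)"
      using z v by (simp add: v(3) flip: P.m_assoc)
    moreover have "y \<otimes>\<^bsub>P\<^esub> f (s \<otimes>\<^bsub>R\<^esub> a) = f (r \<otimes>\<^bsub>R\<^esub> a)"
      using y v(1,2) by (simp flip: P.m_assoc)
    ultimately have "(y \<oplus>\<^bsub>P\<^esub> z) \<otimes>\<^bsub>P\<^esub> f (s \<otimes>\<^bsub>R\<^esub> a) = f (r \<otimes>\<^bsub>R\<^esub> a \<oplus>\<^bsub>R\<^esub> r' \<otimes>\<^bsub>R\<^esub> v)"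
      using y z v by (simp add: P.l_distr del: f.hom_mult)
    then show "y \<oplus>\<^bsub>P\<^esub> z \<in> fractions R S P f"
      unfolding mem using y(1-3) z(1,2) v(1,2) mult
      by (meson P.add.m_closed R.add.m_closed R.m_closed S)
  qed
qed

text \<open>If every generator can be moved past every generating denominator at the cost of replacing the
  denominator, the Ore condition follows by induction on the numerator. Sums need a common multiple of two
  denominators, which is their product as they commute.\<close>

lemma ore_condition_presented_alg:
  fixes G R B
  defines "A \<equiv> presented_alg G R"
  assumes B: "B \<subseteq> carrier A"
    and comm: "\<And>a b. a \<in> B \<Longrightarrow> b \<in> B \<Longrightarrow> a \<otimes>\<^bsub>A\<^esub> b = b \<otimes>\<^bsub>A\<^esub> a"
    and gen: "\<And>g b. g \<in> G \<Longrightarrow> b \<in> B \<Longrightarrow>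
      \<exists>b'\<in>B. alg_cls G R (Gen g) \<otimes>\<^bsub>A\<^esub> b' = b \<otimes>\<^bsub>A\<^esub> alg_cls G R (Gen g)"
    and r: "r \<in> carrier A" and s: "s \<in> mult_closure A B"
  shows "\<exists>r'\<in>carrier A. \<exists>s'\<in>mult_closure A B. r \<otimes>\<^bsub>A\<^esub> s' = s \<otimes>\<^bsub>A\<^esub> r'"
proof -
  interpret ring A unfolding A_def by (rule presented_alg_ring)
  let ?S = "mult_closure A B"
  note Acl = mult_closure_closed[OF ring_axioms B]
  have S [simp]: "s \<in> carrier A" if "s \<in> ?S" for s using Acl that by blast
  have Bc [simp]: "b \<in> carrier A" if "b \<in> B" for b using B that by blast
  note mult = mult_closure_mult[OF ring_axioms B]
  have comm1: "s \<otimes>\<^bsub>A\<^esub> b = b \<otimes>\<^bsub>A\<^esub> s" if "s \<in> ?S" "b \<in> B" for s b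
    using that
  proof induction
    case (mult s b')
    then show ?case by (metis Bc S comm m_assoc)
  qed simp
  have Scomm: "s \<otimes>\<^bsub>A\<^esub> t = t \<otimes>\<^bsub>A\<^esub> s" if "s \<in> ?S" "t \<in> ?S" for s t
    using that(2,1)
  proof induction
    case (mult t b)
    then show ?case using comm1 by (metis Bc S m_assoc)
  qed simp
  show ?thesis
    using r s unfolding A_def
  proof (induction arbitrary: s rule: presented_alg_induct)
    case (const c)
    have "alg_cls G R (Const c) \<otimes>\<^bsub>A\<^esub> s = s \<otimes>\<^bsub>A\<^esub> alg_cls G R (Const c)"
      using const S[of s] presented_alg_const_central unfolding A_def
      by (metis presented_alg_carrier_iff)
    with const show ?case
      unfolding A_def by (intro bexI[of _ s] bexI[of _ "alg_cls G R (Const c)"] presented_alg_closed) simp_all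
  next
    case (gen g)
    let ?g = "alg_cls G R (Gen g)"
    have g: "?g \<in> carrier A" using gen by (simp add: A_def presented_alg_closed)
    have "\<exists>s'\<in>?S. ?g \<otimes>\<^bsub>A\<^esub> s' = s \<otimes>\<^bsub>A\<^esub> ?g"
      using gen(2) unfolding A_def[symmetric]
    proof induction
      case one
      then show ?case using g by (auto intro: mult_closure.one bexI[of _ "\<one>\<^bsub>A\<^esub>"])
    next
      case (mult s b)
      then obtain s' b' where "s' \<in> ?S" "b' \<in> B" "?g \<otimes>\<^bsub>A\<^esub> s' = s \<otimes>\<^bsub>A\<^esub> ?g"
        "?g \<otimes>\<^bsub>A\<^esub> b' = b \<otimes>\<^bsub>A\<^esub> ?g"
        using assms(4)[OF gen(1)] by blast
      then have "?g \<otimes>\<^bsub>A\<^esub> (b' \<otimes>\<^bsub>A\<^esub> s') = (s \<otimes>\<^bsub>A\<^esub> b) \<otimes>\<^bsub>A\<^esub> ?g"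
        using mult g by (metis Bc S comm1 m_assoc)
      moreover have "b' \<otimes>\<^bsub>A\<^esub> s' \<in> ?S"
        using \<open>b' \<in> B\<close> \<open>s' \<in> ?S\<close> comm1 by (metis mult_closure.mult)
      ultimately show ?case by blast
    qed
    with g show ?case unfolding A_def by blast
  next
    case (plus x y)
    note plus = plus[folded A_def]
    obtain x' s1 where 1: "x' \<in> carrier A" "s1 \<in> ?S" "x \<otimes>\<^bsub>A\<^esub> s1 = s \<otimes>\<^bsub>A\<^esub> x'"
      using plus(3)[OF plus(5)] by blast
    obtain y' s2 where 2: "y' \<in> carrier A" "s2 \<in> ?S" "y \<otimes>\<^bsub>A\<^esub> s2 = s \<otimes>\<^bsub>A\<^esub> y'"
      using plus(4)[OF plus(5)] by blast
    have "(x \<oplus>\<^bsub>A\<^esub> y) \<otimes>\<^bsub>A\<^esub> (s1 \<otimes>\<^bsub>A\<^esub> s2) = x \<otimes>\<^bsub>A\<^esub> s1 \<otimes>\<^bsub>A\<^esub> s2 \<oplus>\<^bsub>A\<^esub> y \<otimes>\<^bsub>A\<^esub> s2 \<otimes>\<^bsub>A\<^esub> s1"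
      using plus(1,2) 1(2) 2(2) Scomm[of s1 s2] by (simp add: l_distr m_assoc)
    also have "\<dots> = s \<otimes>\<^bsub>A\<^esub> (x' \<otimes>\<^bsub>A\<^esub> s2 \<oplus>\<^bsub>A\<^esub> y' \<otimes>\<^bsub>A\<^esub> s1)"
      unfolding 1 2 using plus 1(1,2) 2(1,2) by (simp add: r_distr m_assoc)
    finally show ?case
      using 1 2 mult unfolding A_def[symmetric] by (meson S a_closed m_closed)
  next
    case (neg x)
    note neg = neg[folded A_def]
    then obtain x' s1 where 1: "x' \<in> carrier A" "s1 \<in> ?S" "x \<otimes>\<^bsub>A\<^esub> s1 = s \<otimes>\<^bsub>A\<^esub> x'"
      by blast
    then have "\<ominus>\<^bsub>A\<^esub> x \<otimes>\<^bsub>A\<^esub> s1 = s \<otimes>\<^bsub>A\<^esub> \<ominus>\<^bsub>A\<^esub> x'"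
      using neg by (simp add: l_minus r_minus)
    with 1 show ?case unfolding A_def[symmetric] by (meson a_inv_closed)
  next
    case (times x y)
    note times = times[folded A_def]
    obtain x' s1 where 1: "x' \<in> carrier A" "s1 \<in> ?S" "x \<otimes>\<^bsub>A\<^esub> s1 = s \<otimes>\<^bsub>A\<^esub> x'"
      using times(3)[OF times(5)] by blast
    obtain y' s2 where 2: "y' \<in> carrier A" "s2 \<in> ?S" "y \<otimes>\<^bsub>A\<^esub> s2 = s1 \<otimes>\<^bsub>A\<^esub> y'"
      using times(4)[OF 1(2)] by blast
    have "(x \<otimes>\<^bsub>A\<^esub> y) \<otimes>\<^bsub>A\<^esub> s2 = s \<otimes>\<^bsub>A\<^esub> (x' \<otimes>\<^bsub>A\<^esub> y')"
      using times(1,2,5) 1 2 by (simp add: m_assoc) (metis S m_assoc)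
    with 1 2 show ?case unfolding A_def[symmetric] by (meson m_closed)
  qed
qed

text \<open>Minimality of the ring of fractions \<open>F\<close> is applied twice: to \<open>\<sigma> ` F\<close>, which gives \<open>F \<subseteq> \<sigma> ` F\<close>, and to
  the image of \<open>F\<close> under the inverse of \<open>\<sigma>\<close>, which gives \<open>\<sigma> ` F \<subseteq> F\<close>.\<close>

lemma iso_image_fractions:
  fixes G R B P f \<sigma>
  defines "A \<equiv> presented_alg G R"
  defines "F \<equiv> fractions A (mult_closure A B) P f"
  assumes P: "ring P" and f: "f \<in> ring_hom A P" and B: "B \<subseteq> carrier A"
    and F: "subring F P" and \<sigma>: "\<sigma> \<in> ring_iso P P"
    and const: "\<And>c. f (alg_cls G R (Const c)) \<in> F"
      "\<And>c. \<sigma> (f (alg_cls G R (Const c))) = f (alg_cls G R (Const c))"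
    and gen: "\<And>g. g \<in> G \<Longrightarrow> \<sigma> (f (alg_cls G R (Gen g))) \<in> F"
      "\<And>g. g \<in> G \<Longrightarrow> f (alg_cls G R (Gen g)) \<in> \<sigma> ` F"
    and unit: "\<And>b. b \<in> B \<Longrightarrow> \<sigma> (f b) \<in> Units (P\<lparr>carrier := F\<rparr>)"
      "\<And>b. b \<in> B \<Longrightarrow> f b \<in> \<sigma> ` Units (P\<lparr>carrier := F\<rparr>)"
  shows "\<sigma> ` F = F"
proof -
  interpret P: ring P by fact
  have FP: "F \<subseteq> carrier P" using F by (rule subringE)
  have key: "F \<subseteq> \<rho> ` F"
    if \<rho>: "\<rho> \<in> ring_hom P P"
      and c: "\<And>c. \<rho> (f (alg_cls G R (Const c))) = f (alg_cls G R (Const c))"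
      and g: "\<And>g. g \<in> G \<Longrightarrow> f (alg_cls G R (Gen g)) \<in> \<rho> ` F"
      and u: "\<And>b. b \<in> B \<Longrightarrow> f b \<in> \<rho> ` Units (P\<lparr>carrier := F\<rparr>)" for \<rho>
  proof -
    interpret \<rho>: ring_hom_ring P P \<rho> by (intro ring_hom_ringI2 P \<rho>)
    have "\<rho> \<in> ring_hom (P\<lparr>carrier := F\<rparr>) (P\<lparr>carrier := \<rho> ` F\<rparr>)"
      using FP by (auto intro!: ring_hom_memI simp: subset_iff)
    then have "f b \<in> Units (P\<lparr>carrier := \<rho> ` F\<rparr>)" if "b \<in> B" for b
      using u[OF that] by (auto intro: ring_hom_Units)
    moreover have "f (alg_cls G R (Const x)) \<in> \<rho> ` F" for x
      using c const(1) by (metis imageI)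
    ultimately show ?thesis
      unfolding F_def A_def
      using fractions_subset[OF P f[unfolded A_def] B[unfolded A_def] \<rho>.img_is_subring[OF F]] g
      by (auto simp: F_def A_def)
  qed
  have bij: "bij_betw \<sigma> (carrier P) (carrier P)" using \<sigma> by (auto simp: ring_iso_def)
  define \<tau> where "\<tau> = inv_into (carrier P) \<sigma>"
  have \<tau>\<sigma>: "\<tau> (\<sigma> p) = p" if "p \<in> carrier P" for p
    using bij that by (simp add: \<tau>_def bij_betw_inv_into_left)
  have \<sigma>\<tau>: "\<sigma> (\<tau> p) = p" if "p \<in> carrier P" for p
    using bij that by (simp add: \<tau>_def bij_betw_inv_into_right)
  have \<tau>: "\<tau> \<in> ring_hom P P"
    using ring_iso_set_sym[OF P \<sigma>] by (simp add: \<tau>_def ring_iso_def)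
  have fA: "f (alg_cls G R t) \<in> carrier P" if "alg_gens t \<subseteq> G" for t
    using f that by (auto simp: A_def intro: ring_hom_closed presented_alg_closed)
  have "F \<subseteq> \<sigma> ` F"
    using key[of \<sigma>] \<sigma> const gen unit by (simp add: ring_iso_def)
  moreover have "F \<subseteq> \<tau> ` F"
  proof (rule key[OF \<tau>])
    show "\<tau> (f (alg_cls G R (Const c))) = f (alg_cls G R (Const c))" for c
      using \<tau>\<sigma>[OF fA, of "Const c"] const(2)[of c] by simp
    show "f (alg_cls G R (Gen g)) \<in> \<tau> ` F" if "g \<in> G" for g
      using \<tau>\<sigma>[OF fA, of "Gen g"] gen(1)[OF that] that by (force simp: image_iff)
    show "f b \<in> \<tau> ` Units (P\<lparr>carrier := F\<rparr>)" if "b \<in> B" for b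
      using \<tau>\<sigma>[of "f b"] unit(1)[OF that] that f B by (force simp: image_iff ring_hom_closed)
  qed
  then have "\<sigma> ` F \<subseteq> F" using FP \<sigma>\<tau> by (force simp: subset_iff image_iff)
  ultimately show ?thesis by blast
qed


section \<open>The Weyl algebra\<close>

text \<open>Here \<open>g\<close> stands for a generator of weight \<open>a'\<close> with respect to \<open>a\<close> and \<open>b'\<close> with respect to \<open>b\<close>; its weight
  with respect to the difference is \<open>a' - b'\<close>.\<close>

lemma (in ring) shift_commute:
  assumes [simp]: "a \<in> carrier R" "b \<in> carrier R" "c \<in> carrier R" "g \<in> carrier R"
      "a' \<in> carrier R" "b' \<in> carrier R"
    and "a \<otimes> g = g \<otimes> (a \<oplus> a')" "b \<otimes> g = g \<otimes> (b \<oplus> b')" "c \<otimes> g = g \<otimes> c"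
  shows "(a \<ominus> b \<oplus> c) \<otimes> g = g \<otimes> (a \<ominus> b \<oplus> (c \<oplus> a' \<ominus> b'))"
proof -
  have "(a \<ominus> b \<oplus> c) \<otimes> g = g \<otimes> ((a \<oplus> a') \<ominus> (b \<oplus> b') \<oplus> c)"
    using assms(7-9) by (simp add: l_distr r_distr minus_eq l_minus r_minus)
  also have "(a \<oplus> a') \<ominus> (b \<oplus> b') \<oplus> c = a \<ominus> b \<oplus> (c \<oplus> a' \<ominus> b')"
    by (simp add: minus_eq minus_add a_ac)
  finally show ?thesis .
qed

text \<open>The Euler operator \<open>d x\<close> grades the algebra: \<open>x\<close> has weight \<open>1\<close> and \<open>d\<close> has weight \<open>-1\<close>.\<close>

lemma (in ring) heisenberg_euler:
  assumes [simp]: "d \<in> carrier R" "x \<in> carrier R"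
    and dx: "d \<otimes> x = \<one> \<oplus> x \<otimes> d"
  shows "(d \<otimes> x) \<otimes> x = x \<otimes> (d \<otimes> x \<oplus> \<one>)"
    and "(d \<otimes> x) \<otimes> d = d \<otimes> (d \<otimes> x \<oplus> \<ominus> \<one>)"
proof -
  have "(d \<otimes> x) \<otimes> x = (\<one> \<oplus> x \<otimes> d) \<otimes> x" by (simp only: dx)
  then show "(d \<otimes> x) \<otimes> x = x \<otimes> (d \<otimes> x \<oplus> \<one>)"
    by (simp add: l_distr r_distr m_assoc a_comm)
  have "x \<otimes> d = d \<otimes> x \<oplus> \<ominus> \<one>"
    by (simp add: dx a_comm[of \<one> "x \<otimes> d"] a_assoc r_neg)
  then show "(d \<otimes> x) \<otimes> d = d \<otimes> (d \<otimes> x \<oplus> \<ominus> \<one>)" by (simp add: m_assoc)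
qed

text \<open>The second parameter carries no data; it fixes the type of the ground ring.\<close>

locale weyl_algebra =
  fixes n :: nat and ground_ring :: "'k::comm_ring_1 itself"
begin

abbreviation W :: "'k weyl_term set ring" where "W \<equiv> Weyl n"
abbreviation W_X :: "nat \<Rightarrow> 'k weyl_term set" where "W_X j \<equiv> weyl_cls n (wX j)"
abbreviation W_D :: "nat \<Rightarrow> 'k weyl_term set" where "W_D j \<equiv> weyl_cls n (wD j)"
abbreviation W_H :: "nat \<Rightarrow> 'k weyl_term set" where "W_H j \<equiv> weyl_cls n (wH j)"
definition W_C :: "int \<Rightarrow> 'k weyl_term set" where "W_C c = weyl_cls n (Const (of_int c))"
definition W_T :: "nat \<Rightarrow> nat \<Rightarrow> int \<Rightarrow> 'k weyl_term set" where
  "W_T j k c = weyl_cls n (wH j - wH k + Const (of_int c))"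

sublocale ring W
  unfolding Weyl_def by (rule presented_alg_ring)

lemma weyl_gens [simp]: "j \<in> {1..n} \<Longrightarrow> WXGen j \<in> weyl_gens n" "j \<in> {1..n} \<Longrightarrow> WDGen j \<in> weyl_gens n"
  by (auto simp: weyl_gens_def)

lemma weyl_closed [simp]: "alg_gens t \<subseteq> weyl_gens n \<Longrightarrow> weyl_cls n t \<in> carrier W"
  by (simp add: Weyl_def weyl_cls_def presented_alg_closed)

lemma wH_gens [simp]: "j \<in> {1..n} \<Longrightarrow> alg_gens (wH j) \<subseteq> weyl_gens n"
  by (simp add: wH_def)

lemma W_C_closed [simp]: "W_C c \<in> carrier W"
  by (simp add: W_C_def)

lemma W_T_closed [simp]: "j \<in> {1..n} \<Longrightarrow> k \<in> {1..n} \<Longrightarrow> W_T j k c \<in> carrier W"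
  by (simp add: W_T_def)

lemma XX: "i \<in> {1..n} \<Longrightarrow> j \<in> {1..n} \<Longrightarrow> W_X i \<otimes>\<^bsub>W\<^esub> W_X j = W_X j \<otimes>\<^bsub>W\<^esub> W_X i"
  using alg_cls_rel[OF weyl_rels.X_X, of i n j]
  by (simp add: Weyl_def weyl_cls_def presented_alg_mult)

lemma DD: "i \<in> {1..n} \<Longrightarrow> j \<in> {1..n} \<Longrightarrow> W_D i \<otimes>\<^bsub>W\<^esub> W_D j = W_D j \<otimes>\<^bsub>W\<^esub> W_D i"
  using alg_cls_rel[OF weyl_rels.D_D, of i n j]
  by (simp add: Weyl_def weyl_cls_def presented_alg_mult)

lemma DX: "i \<in> {1..n} \<Longrightarrow> j \<in> {1..n} \<Longrightarrow>
    W_D i \<otimes>\<^bsub>W\<^esub> W_X j = (if i = j then \<one>\<^bsub>W\<^esub> else \<zero>\<^bsub>W\<^esub>) \<oplus>\<^bsub>W\<^esub> W_X j \<otimes>\<^bsub>W\<^esub> W_D i"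
  using alg_cls_rel[OF weyl_rels.D_X, of i n j]
  by (cases "i = j") (simp_all add: Weyl_def weyl_cls_def presented_alg_mult presented_alg_add
      presented_alg_zero presented_alg_one)

lemma H_eq: "j \<in> {1..n} \<Longrightarrow> W_H j = W_D j \<otimes>\<^bsub>W\<^esub> W_X j"
  by (simp add: Weyl_def weyl_cls_def presented_alg_mult wH_def)

lemma C_simps: "W_C (a + b) = W_C a \<oplus>\<^bsub>W\<^esub> W_C b" "W_C (a - b) = W_C a \<ominus>\<^bsub>W\<^esub> W_C b" "W_C (- a) = \<ominus>\<^bsub>W\<^esub> W_C a"
    "W_C 0 = \<zero>\<^bsub>W\<^esub>" "W_C 1 = \<one>\<^bsub>W\<^esub>"
  using alg_cls_const_add[of _ _ "of_int a" "- of_int b"]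
  by (simp_all add: W_C_def Weyl_def weyl_cls_def alg_cls_const_add alg_cls_const_minus alg_cls_const_one
      alg_cls_const_zero a_minus_def)

lemma T_eq: "j \<in> {1..n} \<Longrightarrow> k \<in> {1..n} \<Longrightarrow> W_T j k c = W_H j \<ominus>\<^bsub>W\<^esub> W_H k \<oplus>\<^bsub>W\<^esub> W_C c"
  by (simp add: W_T_def W_C_def Weyl_def weyl_cls_def presented_alg_diff presented_alg_add)

lemma H_X:
  assumes j: "j \<in> {1..n}" and m: "m \<in> {1..n}"
  shows "W_H j \<otimes>\<^bsub>W\<^esub> W_X m = W_X m \<otimes>\<^bsub>W\<^esub> (W_H j \<oplus>\<^bsub>W\<^esub> W_C (of_bool (j = m)))"
proof (cases "j = m")
  case True
  with assms heisenberg_euler(1)[of "W_D j" "W_X j"] show ?thesis by (simp add: H_eq DX C_simps)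
next
  case False
  with assms DX[of j m] have "W_D j \<otimes>\<^bsub>W\<^esub> W_X m = W_X m \<otimes>\<^bsub>W\<^esub> W_D j" by simp
  then have "W_D j \<otimes>\<^bsub>W\<^esub> (W_X j \<otimes>\<^bsub>W\<^esub> W_X m) = W_X m \<otimes>\<^bsub>W\<^esub> (W_D j \<otimes>\<^bsub>W\<^esub> W_X j)"
    using assms by (simp add: XX[of j m] flip: m_assoc)
  with False assms show ?thesis by (simp add: H_eq C_simps m_assoc)
qed

lemma H_D:
  assumes j: "j \<in> {1..n}" and m: "m \<in> {1..n}"
  shows "W_H j \<otimes>\<^bsub>W\<^esub> W_D m = W_D m \<otimes>\<^bsub>W\<^esub> (W_H j \<oplus>\<^bsub>W\<^esub> W_C (- of_bool (j = m)))"
proof (cases "j = m")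
  case True
  with assms heisenberg_euler(2)[of "W_D j" "W_X j"] show ?thesis by (simp add: H_eq DX C_simps)
next
  case False
  with assms DX[of m j] have "W_X j \<otimes>\<^bsub>W\<^esub> W_D m = W_D m \<otimes>\<^bsub>W\<^esub> W_X j" by simp
  then have "W_D j \<otimes>\<^bsub>W\<^esub> (W_X j \<otimes>\<^bsub>W\<^esub> W_D m) = W_D m \<otimes>\<^bsub>W\<^esub> (W_D j \<otimes>\<^bsub>W\<^esub> W_X j)"
    using assms by (simp add: DD[of j m] flip: m_assoc)
  with False assms show ?thesis by (simp add: H_eq C_simps m_assoc)
qed

lemma C_central:
  "x \<in> carrier W \<Longrightarrow> W_C c \<otimes>\<^bsub>W\<^esub> x = x \<otimes>\<^bsub>W\<^esub> W_C c"
  using presented_alg_const_central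
  by (fastforce simp: W_C_def Weyl_def weyl_cls_def presented_alg_carrier_iff)

lemma HH:
  assumes "j \<in> {1..n}" and "k \<in> {1..n}"
  shows "W_H j \<otimes>\<^bsub>W\<^esub> W_H k = W_H k \<otimes>\<^bsub>W\<^esub> W_H j"
proof (cases "j = k")
  case False
  have "W_H j \<otimes>\<^bsub>W\<^esub> W_X k = W_X k \<otimes>\<^bsub>W\<^esub> W_H j" "W_H j \<otimes>\<^bsub>W\<^esub> W_D k = W_D k \<otimes>\<^bsub>W\<^esub> W_H j"
    using False assms by (simp_all add: H_X H_D C_simps)
  moreover have "W_H j \<otimes>\<^bsub>W\<^esub> (W_D k \<otimes>\<^bsub>W\<^esub> W_X k) = W_D k \<otimes>\<^bsub>W\<^esub> (W_H j \<otimes>\<^bsub>W\<^esub> W_X k)"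
    using assms calculation(2) by (simp flip: m_assoc)
  ultimately show ?thesis
    unfolding H_eq[OF assms(2)] using assms by (simp add: m_assoc)
qed simp

lemma TT:
  assumes "j \<in> {1..n}" "k \<in> {1..n}" "j' \<in> {1..n}" "k' \<in> {1..n}"
  shows "W_T j k c \<otimes>\<^bsub>W\<^esub> W_T j' k' c' = W_T j' k' c' \<otimes>\<^bsub>W\<^esub> W_T j k c"
proof -
  let ?t = "W_T j' k' c'"
  have "W_H i \<otimes>\<^bsub>W\<^esub> ?t = ?t \<otimes>\<^bsub>W\<^esub> W_H i" if "i \<in> {1..n}" for i
    using that assms
    by (simp add: T_eq l_distr r_distr minus_eq l_minus r_minus HH[of i] C_central[of "W_H i"])
  moreover have "W_C c \<otimes>\<^bsub>W\<^esub> ?t = ?t \<otimes>\<^bsub>W\<^esub> W_C c"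
    using assms by (simp add: C_central)
  ultimately show ?thesis
    unfolding T_eq[OF assms(1,2), of c] using assms
    by (simp add: l_distr r_distr minus_eq l_minus r_minus)
qed

lemma T_X:
  assumes "j \<in> {1..n}" "k \<in> {1..n}" "m \<in> {1..n}"
  shows "W_T j k c \<otimes>\<^bsub>W\<^esub> W_X m = W_X m \<otimes>\<^bsub>W\<^esub> W_T j k (c + of_bool (j = m) - of_bool (k = m))"
  unfolding T_eq[OF assms(1,2)] C_simps(1,2) using assms
  by (intro shift_commute) (simp_all add: H_X C_central)

lemma T_D:
  assumes "j \<in> {1..n}" "k \<in> {1..n}" "m \<in> {1..n}"
  shows "W_T j k c \<otimes>\<^bsub>W\<^esub> W_D m = W_D m \<otimes>\<^bsub>W\<^esub> W_T j k (c + (- of_bool (j = m)) - (- of_bool (k = m)))"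
  unfolding T_eq[OF assms(1,2)] C_simps(1,2) using assms
  by (intro shift_commute) (simp_all add: H_D C_central)

lemma T_swap:
  assumes "j \<in> {1..n}" "k \<in> {1..n}"
  shows "W_T j k c = \<ominus>\<^bsub>W\<^esub> W_T k j (- c)"
  using assms by (simp add: T_eq C_simps minus_eq minus_add a_ac)

text \<open>The generators are defined by \<open>X\<^sup>j D\<^sub>j\<close>, whereas \<open>\<H>\<^sub>j = D\<^sub>j X\<^sup>j = X\<^sup>j D\<^sub>j + 1\<close>; the ones cancel in differences.\<close>

lemma T0_gens_eq: "T0_gens n = {W_T j k c | j k c. 1 \<le> j \<and> j < k \<and> k \<le> n}"
proof -
  have "weyl_cls n (wX j * wD j - wX k * wD k + Const (of_int c)) = W_T j k c"
    if "j \<in> {1..n}" "k \<in> {1..n}" for j k c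
  proof -
    have X: "W_X i \<otimes>\<^bsub>W\<^esub> W_D i = W_H i \<ominus>\<^bsub>W\<^esub> \<one>\<^bsub>W\<^esub>" if "i \<in> {1..n}" for i
      using that by (simp add: H_eq DX minus_eq a_ac r_neg2 r_neg)
    have "weyl_cls n (wX j * wD j - wX k * wD k + Const (of_int c))
        = W_X j \<otimes>\<^bsub>W\<^esub> W_D j \<ominus>\<^bsub>W\<^esub> W_X k \<otimes>\<^bsub>W\<^esub> W_D k \<oplus>\<^bsub>W\<^esub> W_C c"
      using that by (simp add: W_C_def Weyl_def weyl_cls_def presented_alg_diff presented_alg_add presented_alg_mult)
    also have "W_X j \<otimes>\<^bsub>W\<^esub> W_D j \<ominus>\<^bsub>W\<^esub> W_X k \<otimes>\<^bsub>W\<^esub> W_D k = W_H j \<ominus>\<^bsub>W\<^esub> W_H k"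
      using that by (simp add: X minus_eq minus_add a_ac r_neg2 r_neg r_neg1)
    finally show ?thesis using that by (simp add: T_eq)
  qed
  then show ?thesis
    unfolding T0_gens_def by (intro Collect_cong ex_cong1) auto
qed

lemma T0_gens_closed: "T0_gens n \<subseteq> carrier W"
  by (auto simp: T0_gens_eq)

lemma T_gens_closed: "T0_gens n \<union> W_X ` {1..n} \<subseteq> carrier W"
  using T0_gens_closed by auto

lemma T0_subset_T: "(T0_set n :: 'k weyl_term set set) \<subseteq> T_set n"
proof
  fix t :: "'k weyl_term set" assume "t \<in> T0_set n"
  then show "t \<in> T_set n" unfolding T0_set_def T_set_def
    by induction (auto intro: mult_closure.intros)
qed

lemma T_set_closed: "T_set n \<subseteq> carrier W"
  unfolding T_set_def by (rule mult_closure_closed[OF ring_axioms T_gens_closed])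

lemma T_zero:
  assumes "j \<in> {1..n}" "k \<in> {1..n}"
  shows "W_T j k 0 = weyl_cls n (wH j - wH k)"
proof -
  have "weyl_cls n (wH j - wH k) = W_H j \<ominus>\<^bsub>W\<^esub> W_H k"
    using assms by (simp add: Weyl_def weyl_cls_def presented_alg_diff)
  then show ?thesis using assms by (simp add: T_eq C_simps(4))
qed

lemma T0_ore:
  assumes "r \<in> carrier W" "s \<in> T0_set n"
  shows "\<exists>r'\<in>carrier W. \<exists>s'\<in>T0_set n. r \<otimes>\<^bsub>W\<^esub> s' = s \<otimes>\<^bsub>W\<^esub> r'"
  using assms unfolding T0_set_def Weyl_def
proof (rule ore_condition_presented_alg[rotated 3], goal_cases)
  case 1
  then show ?case using T0_gens_closed by (simp add: Weyl_def)
next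
  case (2 a b)
  then show ?case using TT unfolding T0_gens_eq Weyl_def[symmetric] by auto
next
  case (3 g b)
  then obtain j k c where b: "b = W_T j k c" "1 \<le> j" "j < k" "k \<le> n" by (auto simp: T0_gens_eq)
  have "\<exists>c'. weyl_cls n (Gen g) \<otimes>\<^bsub>W\<^esub> W_T j k c' = W_T j k c \<otimes>\<^bsub>W\<^esub> weyl_cls n (Gen g)"
  proof (cases g)
    case (WXGen m)
    with 3(1) b show ?thesis using T_X[of j k m c] by (auto simp: weyl_gens_def)
  next
    case (WDGen m)
    with 3(1) b show ?thesis using T_D[of j k m c] by (auto simp: weyl_gens_def)
  qed
  with b show ?case by (auto simp: T0_gens_eq Weyl_def weyl_cls_def)
qed

lemma T0_fractions_subring:
  assumes "ring P" "f \<in> ring_hom W P" "f ` T0_set n \<subseteq> Units P"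
  shows "subring (fractions W (T0_set n) P f) P"
  using assms mult_closure_closed[OF ring_axioms T0_gens_closed]
    mult_closure_mult[OF ring_axioms T0_gens_closed]
  by (intro fractions_subring ring_axioms T0_ore) (auto simp: T0_set_def intro: mult_closure.one)

end


section \<open>The polynomial ring over the localized Weyl algebra\<close>

lemma PW_ring: "ring (PW n L l)"
  unfolding PW_def tensor_alg_def by (rule presented_alg_ring)

lemma PW_emb_hom:
  assumes "ring L"
  shows "PW_emb n L l \<in> ring_hom L (PW n L l)"
proof -
  interpret L: ring L by fact
  interpret Poly: ring "Poly n" unfolding Poly_def by (rule presented_alg_ring)
  let ?\<alpha> = "\<lambda>c. poly_cls n (Const c)" and ?\<beta> = "\<lambda>c. l (weyl_cls n (Const c))"
  let ?rels = "tensor_rels (Poly n) ?\<alpha> L ?\<beta>"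
  note defs = PW_emb_def PW_def PW_cls_def tensor_alg_def tensor_cls_def
  show ?thesis
  proof (rule ring_hom_memI)
    fix x y assume xy: "x \<in> carrier L" "y \<in> carrier L"
    show "PW_emb n L l x \<in> carrier (PW n L l)"
      using xy by (simp add: defs presented_alg_closed)
    have "(Gen (\<one>\<^bsub>Poly n\<^esub> \<otimes>\<^bsub>Poly n\<^esub> \<one>\<^bsub>Poly n\<^esub>, x \<otimes>\<^bsub>L\<^esub> y), Gen (\<one>\<^bsub>Poly n\<^esub>, x) * Gen (\<one>\<^bsub>Poly n\<^esub>, y)) \<in> ?rels"
      using xy by (intro tensor_rels.mult) auto
    with xy show "PW_emb n L l (x \<otimes>\<^bsub>L\<^esub> y) = PW_emb n L l x \<otimes>\<^bsub>PW n L l\<^esub> PW_emb n L l y"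
      by (simp add: defs presented_alg_mult alg_cls_rel)
    have "(Gen (\<one>\<^bsub>Poly n\<^esub>, x \<oplus>\<^bsub>L\<^esub> y), Gen (\<one>\<^bsub>Poly n\<^esub>, x) + Gen (\<one>\<^bsub>Poly n\<^esub>, y)) \<in> ?rels"
      using xy by (intro tensor_rels.add_r) auto
    with xy show "PW_emb n L l (x \<oplus>\<^bsub>L\<^esub> y) = PW_emb n L l x \<oplus>\<^bsub>PW n L l\<^esub> PW_emb n L l y"
      by (simp add: defs presented_alg_add alg_cls_rel)
  next
    show "PW_emb n L l \<one>\<^bsub>L\<^esub> = \<one>\<^bsub>PW n L l\<^esub>"
      by (simp add: defs presented_alg_one alg_cls_rel[OF tensor_rels.one])
  qed
qed

lemma PW_emb_const:
  assumes "ring L" "l \<in> ring_hom (Weyl n) L"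
  shows "PW_emb n L l (l (weyl_cls n (Const c))) = PW_cls n L l (Const c)"
proof -
  interpret L: ring L by fact
  interpret Poly: ring "Poly n" unfolding Poly_def by (rule presented_alg_ring)
  let ?\<alpha> = "\<lambda>c. poly_cls n (Const c)" and ?\<beta> = "\<lambda>c. l (weyl_cls n (Const c))"
  let ?rels = "tensor_rels (Poly n) ?\<alpha> L ?\<beta>"
  note [trans] = alg_eq.trans
  have "?\<beta> c \<in> carrier L"
    by (rule ring_hom_closed[OF assms(2)]) (simp add: Weyl_def weyl_cls_def presented_alg_closed)
  moreover have "(Gen (\<one>\<^bsub>Poly n\<^esub>, ?\<beta> c \<otimes>\<^bsub>L\<^esub> \<one>\<^bsub>L\<^esub>), Const c * Gen (\<one>\<^bsub>Poly n\<^esub>, \<one>\<^bsub>L\<^esub>)) \<in> ?rels"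
    by (intro tensor_rels.scale_r) auto
  ultimately have "alg_eq ?rels (Gen (\<one>\<^bsub>Poly n\<^esub>, ?\<beta> c)) (Const c * Gen (\<one>\<^bsub>Poly n\<^esub>, \<one>\<^bsub>L\<^esub>))"
    by (auto intro: alg_eq.rel)
  also have "alg_eq ?rels (Const c * Gen (\<one>\<^bsub>Poly n\<^esub>, \<one>\<^bsub>L\<^esub>)) (Const c * 1)"
    by (intro alg_eq.cong_times alg_eq.refl alg_eq.rel tensor_rels.one)
  also have "alg_eq ?rels (Const c * 1) (Const c)" by (rule alg_eq.times_one)
  finally show ?thesis
    by (simp add: PW_emb_def PW_cls_def tensor_cls_def alg_cls_eqI)
qed


section \<open>The Zhelobenko automorphisms on the elements x psi'\<close>

text \<open>The cancellation behind the normalization of \<open>x\<^sup>i \<psi>\<^sub>i'\<close>: with \<open>u = h\<^sub>i\<^sub>,\<^sub>i\<^sub>+\<^sub>1\<close>, \<open>x = x\<^sup>i\<^sup>+\<^sup>1\<close>, \<open>y = 1 / (u - 1)\<close>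
  and \<open>a = \<Prod>\<^sub>k\<^sub><\<^sub>i h\<^sub>i\<^sub>+\<^sub>1\<^sub>,\<^sub>k\<close>, the element multiplied by \<open>u\<close> on the left is the image of \<open>x\<^sup>i \<psi>\<^sub>i'\<close> under the
  automorphism, and the right-hand side is \<open>x\<^sup>i\<^sup>+\<^sup>1 \<psi>'\<^sub>i\<^sub>+\<^sub>1\<close>.\<close>

lemma (in ring) twist_identity:
  assumes [simp]: "u \<in> carrier R" "x \<in> carrier R" "y \<in> carrier R" "a \<in> carrier R"
    and ux: "u \<otimes> x = x \<otimes> (u \<ominus> \<one>)" and inv: "(u \<ominus> \<one>) \<otimes> y = \<one>" and ua: "u \<otimes> a = a \<otimes> u"
  shows "u \<otimes> (\<ominus> (x \<otimes> (u \<otimes> y)) \<otimes> a) = x \<otimes> (a \<otimes> \<ominus> u)"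
proof -
  have "u \<otimes> (x \<otimes> (u \<otimes> y)) = (u \<otimes> x) \<otimes> (u \<otimes> y)" by (simp add: m_assoc)
  also have "\<dots> = x \<otimes> (((u \<ominus> \<one>) \<otimes> u) \<otimes> y)" by (simp add: ux m_assoc)
  also have "(u \<ominus> \<one>) \<otimes> u = u \<otimes> (u \<ominus> \<one>)" by (simp add: l_distr r_distr minus_eq l_minus r_minus)
  also have "x \<otimes> (u \<otimes> (u \<ominus> \<one>) \<otimes> y) = x \<otimes> u" using inv by (simp add: m_assoc)
  finally have "(u \<otimes> (x \<otimes> (u \<otimes> y))) \<otimes> a = x \<otimes> (a \<otimes> u)" by (simp add: m_assoc ua)
  then show ?thesis by (simp add: l_minus r_minus m_assoc)
qed

locale diff_algebra =
  fixes n :: nat and ground_ring :: "'k::comm_ring_1 itself"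
begin

abbreviation DR :: "'k diff_term set ring" where "DR \<equiv> Diff_h n"
abbreviation cls :: "'k diff_term \<Rightarrow> 'k diff_term set" where "cls \<equiv> diff_cls n"

sublocale ring DR
  unfolding Diff_h_def by (rule presented_alg_ring)

lemma diff_gens [simp]:
  "j \<in> {1..n} \<Longrightarrow> HGen j \<in> diff_gens n" "j \<in> {1..n} \<Longrightarrow> XGen j \<in> diff_gens n"
  "\<lbrakk>j \<in> {1..n}; k \<in> {1..n}; j \<noteq> k\<rbrakk> \<Longrightarrow> HInv j k c \<in> diff_gens n"
  by (auto simp: diff_gens_def)

lemma cls_closed [simp]: "alg_gens t \<subseteq> diff_gens n \<Longrightarrow> cls t \<in> carrier DR"
  by (simp add: Diff_h_def diff_cls_def presented_alg_closed)

lemma cls_simps: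
  "\<lbrakk>alg_gens s \<subseteq> diff_gens n; alg_gens t \<subseteq> diff_gens n\<rbrakk> \<Longrightarrow> cls (s * t) = cls s \<otimes>\<^bsub>DR\<^esub> cls t"
  "\<lbrakk>alg_gens s \<subseteq> diff_gens n; alg_gens t \<subseteq> diff_gens n\<rbrakk> \<Longrightarrow> cls (s + t) = cls s \<oplus>\<^bsub>DR\<^esub> cls t"
  "\<lbrakk>alg_gens s \<subseteq> diff_gens n; alg_gens t \<subseteq> diff_gens n\<rbrakk> \<Longrightarrow> cls (s - t) = cls s \<ominus>\<^bsub>DR\<^esub> cls t"
  "alg_gens t \<subseteq> diff_gens n \<Longrightarrow> cls (- t) = \<ominus>\<^bsub>DR\<^esub> cls t"
  "cls 1 = \<one>\<^bsub>DR\<^esub>" "cls 0 = \<zero>\<^bsub>DR\<^esub>"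
  by (simp_all add: Diff_h_def diff_cls_def presented_alg_mult presented_alg_add
      presented_alg_diff presented_alg_neg presented_alg_one presented_alg_zero)

lemma cls_rel: "(s, t) \<in> diff_rels n \<Longrightarrow> cls s = cls t"
  by (simp add: diff_cls_def alg_cls_rel)

lemma tprod_gens [simp]: "(\<And>t. t \<in> set ts \<Longrightarrow> alg_gens t \<subseteq> G) \<Longrightarrow> alg_gens (tprod ts) \<subseteq> G"
  for ts :: "('k, 'g) alg_term list"
  by (induction ts) auto

lemma tprod_map_gens:
  "(\<And>k. k \<in> set ks \<Longrightarrow> alg_gens (f k) \<subseteq> G) \<Longrightarrow> alg_gens (tprod (map f ks)) \<subseteq> G"
  for f :: "'a \<Rightarrow> ('k, 'g) alg_term"
  by (induction ks) auto

lemma psi'_gens [simp]: "j \<in> {1..n} \<Longrightarrow> alg_gens (psi' j :: 'k diff_term) \<subseteq> diff_gens n"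
  unfolding psi'_def by (rule tprod_gens) auto

lemma cls_tprod_append:
  assumes "\<And>t. t \<in> set ss \<union> set ts \<Longrightarrow> alg_gens t \<subseteq> diff_gens n"
  shows "cls (tprod (ss @ ts)) = cls (tprod ss) \<otimes>\<^bsub>DR\<^esub> cls (tprod ts)"
  using assms
proof (induction ss)
  case (Cons s ss)
  then have "alg_gens s \<subseteq> diff_gens n" "alg_gens (tprod ss) \<subseteq> diff_gens n"
      "alg_gens (tprod ts) \<subseteq> diff_gens n" "alg_gens (tprod (ss @ ts)) \<subseteq> diff_gens n"
    by (simp_all, metis Un_iff set_append tprod_gens)
  with Cons show ?case by (simp add: cls_simps m_assoc)
qed (simp add: cls_simps)

lemma hh_commute:
  "j \<in> {1..n} \<Longrightarrow> k \<in> {1..n} \<Longrightarrow> cls (hh j) \<otimes>\<^bsub>DR\<^esub> cls (hh k) = cls (hh k) \<otimes>\<^bsub>DR\<^esub> cls (hh j)"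
  using cls_rel[OF diff_rels.h_comm, of j k] by (simp add: cls_simps)

lemma hd2_commute:
  assumes "a \<in> {1..n}" "b \<in> {1..n}" "j \<in> {1..n}" "k \<in> {1..n}"
  shows "cls (hd2 a b) \<otimes>\<^bsub>DR\<^esub> cls (hd2 j k) = cls (hd2 j k) \<otimes>\<^bsub>DR\<^esub> cls (hd2 a b)"
proof -
  have "cls (hh c) \<otimes>\<^bsub>DR\<^esub> cls (hd2 j k) = cls (hd2 j k) \<otimes>\<^bsub>DR\<^esub> cls (hh c)" if "c \<in> {1..n}" for c
    using assms that by (simp add: cls_simps l_distr r_distr minus_eq l_minus r_minus hh_commute[of c])
  moreover have "cls (hd2 j k) \<in> carrier DR" using assms by simp
  moreover have "cls (hd2 a b) = cls (hh a) \<ominus>\<^bsub>DR\<^esub> cls (hh b)" using assms by (simp add: cls_simps)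
  ultimately show ?thesis
    using assms by (simp add: l_distr r_distr minus_eq l_minus r_minus)
qed

lemma tprod_commute:
  assumes x: "x \<in> carrier DR"
    and "\<And>t. t \<in> set ts \<Longrightarrow> alg_gens t \<subseteq> diff_gens n \<and> x \<otimes>\<^bsub>DR\<^esub> cls t = cls t \<otimes>\<^bsub>DR\<^esub> x"
  shows "x \<otimes>\<^bsub>DR\<^esub> cls (tprod ts) = cls (tprod ts) \<otimes>\<^bsub>DR\<^esub> x"
  using assms(2)
proof (induction ts)
  case (Cons t ts)
  then have t: "alg_gens t \<subseteq> diff_gens n" "alg_gens (tprod ts) \<subseteq> diff_gens n"
      "x \<otimes>\<^bsub>DR\<^esub> cls t = cls t \<otimes>\<^bsub>DR\<^esub> x" "x \<otimes>\<^bsub>DR\<^esub> cls (tprod ts) = cls (tprod ts) \<otimes>\<^bsub>DR\<^esub> x"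
    by (auto intro!: tprod_gens)
  have "x \<otimes>\<^bsub>DR\<^esub> (cls t \<otimes>\<^bsub>DR\<^esub> cls (tprod ts)) = (x \<otimes>\<^bsub>DR\<^esub> cls t) \<otimes>\<^bsub>DR\<^esub> cls (tprod ts)"
    using x t(1,2) by (simp add: m_assoc)
  also have "\<dots> = cls t \<otimes>\<^bsub>DR\<^esub> (x \<otimes>\<^bsub>DR\<^esub> cls (tprod ts))"
    using x t(1,2) by (simp add: t(3) m_assoc)
  also have "\<dots> = cls t \<otimes>\<^bsub>DR\<^esub> cls (tprod ts) \<otimes>\<^bsub>DR\<^esub> x"
    using x t(1,2) by (simp add: t(4) m_assoc)
  finally show ?case using t(1,2) by (simp add: cls_simps)
qed (use x in \<open>simp add: cls_simps\<close>)

lemma psi'_Suc: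
  assumes "Suc i \<in> {1..n}" "i \<in> {1..n}"
  shows "cls (psi' (Suc i)) = cls (tprod (map (hd2 (Suc i)) [1..<i])) \<otimes>\<^bsub>DR\<^esub> cls (hd2 (Suc i) i)"
proof -
  have "[1..<Suc i] = [1..<i] @ [i]" using assms by simp
  then show ?thesis
    unfolding psi'_def using assms
    by (simp only: map_append) (subst cls_tprod_append, auto simp: cls_simps)
qed

lemma hd2_xx:
  assumes "i \<in> {1..n}" "j \<in> {1..n}" "i \<noteq> j"
  shows "cls (hd2 i j) \<otimes>\<^bsub>DR\<^esub> cls (xx j) = cls (xx j) \<otimes>\<^bsub>DR\<^esub> (cls (hd2 i j) \<ominus>\<^bsub>DR\<^esub> \<one>\<^bsub>DR\<^esub>)"
  using assms cls_rel[OF diff_rels.h_x, of i j] cls_rel[OF diff_rels.h_x, of j j]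
    shift_commute[of "cls (hh i)" "cls (hh j)" "\<zero>\<^bsub>DR\<^esub>" "cls (xx j)" "\<zero>\<^bsub>DR\<^esub>" "\<one>\<^bsub>DR\<^esub>"]
  by (simp add: cls_simps minus_eq)

end

locale zhelobenko_automorphism = diff_algebra n ground_ring
  for n :: nat and ground_ring :: "'k::comm_ring_1 itself" +
  fixes i :: nat and q :: "'k diff_term set \<Rightarrow> 'k diff_term set"
  assumes i: "i \<in> {1..<n}" and zhelobenko: "zhelobenko n i q"
begin

abbreviation s :: "nat \<Rightarrow> nat" where "s \<equiv> Transposition.transpose i (i + 1)"

lemma s_range [simp]: "j \<in> {1..n} \<Longrightarrow> s j \<in> {1..n}"
  using i by (auto simp: transpose_def)

sublocale q: ring_hom_ring DR DR q
  using zhelobenko by (intro ring_hom_ringI2 ring_axioms) (simp add: zhelobenko_def ring_iso_def)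

lemma q_hh: "j \<in> {1..n} \<Longrightarrow> q (cls (hh j)) = cls (hh (s j))"
  using zhelobenko unfolding zhelobenko_def by blast

lemma q_hd2:
  assumes "j \<in> {1..n}" "k \<in> {1..n}"
  shows "q (cls (hd2 j k)) = cls (hd2 (s j) (s k))"
proof -
  have cl: "cls (hd2 a b) = cls (hh a) \<ominus>\<^bsub>DR\<^esub> cls (hh b)" if "a \<in> {1..n}" "b \<in> {1..n}" for a b
    using that by (simp add: cls_simps)
  have "q (cls (hd2 j k)) = q (cls (hh j)) \<ominus>\<^bsub>DR\<^esub> q (cls (hh k))"
    using assms by (simp add: cl minus_eq)
  then show ?thesis
    unfolding q_hh[OF assms(1)] q_hh[OF assms(2)] cl[OF s_range[OF assms(1)] s_range[OF assms(2)]] .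
qed

lemma q_tprod:
  assumes "\<And>k. k \<in> set ks \<Longrightarrow> alg_gens (f k) \<subseteq> diff_gens n \<and> alg_gens (g k) \<subseteq> diff_gens n
    \<and> q (cls (f k)) = cls (g k)"
  shows "q (cls (tprod (map f ks))) = cls (tprod (map g ks))"
  using assms
proof (induction ks)
  case (Cons k ks)
  then have "alg_gens (tprod (map f ks)) \<subseteq> diff_gens n" "alg_gens (tprod (map g ks)) \<subseteq> diff_gens n"
    by (intro tprod_map_gens; simp)+
  with Cons show ?case by (simp add: cls_simps)
qed (simp add: cls_simps)

lemma q_psi':
  assumes "j \<in> {1..n}"
  shows "q (cls (psi' j)) = cls (tprod (map (\<lambda>k. hd2 (s j) (s k)) [1..<j]))"
  unfolding psi'_def
proof (rule q_tprod)
  fix k assume "k \<in> set [1..<j]"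
  then have "k \<in> {1..n}" using assms by auto
  with assms show "alg_gens (hd2 j k) \<subseteq> diff_gens n \<and> alg_gens (hd2 (s j) (s k)) \<subseteq> diff_gens n \<and>
      q (cls (hd2 j k)) = cls (hd2 (s j) (s k))"
    using s_range[OF assms] s_range[of k] q_hd2[of j k] by (simp del: s_range)
qed

lemma q_x_psi'_lower:
  "cls (hd2 i (i + 1)) \<otimes>\<^bsub>DR\<^esub> q (cls (xx i * psi' i)) = cls (xx (i + 1) * psi' (i + 1))"
proof -
  let ?i' = "Suc i"
  have ii: "i \<in> {1..n}" "?i' \<in> {1..n}" using i by auto
  define u x y a where "u = cls (hd2 i ?i')" and "x = cls (xx ?i')" and "y = cls (hinv i ?i' (- 1))"
    and "a = cls (tprod (map (hd2 ?i') [1..<i]))"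
  have ga: "alg_gens (tprod (map (hd2 ?i' :: nat \<Rightarrow> 'k diff_term) [1..<i])) \<subseteq> diff_gens n"
    using ii by (intro tprod_gens) auto
  have cl [simp]: "u \<in> carrier DR" "x \<in> carrier DR" "y \<in> carrier DR" "a \<in> carrier DR"
    using ii ga by (auto simp: u_def x_def y_def a_def)
  have a: "q (cls (psi' i)) = a"
    using ii unfolding a_def by (subst q_psi') (auto simp: transpose_def intro!: arg_cong[of _ _ "\<lambda>t. cls (tprod t)"])
  have "q (cls (xx i)) = \<ominus>\<^bsub>DR\<^esub> (x \<otimes>\<^bsub>DR\<^esub> (u \<otimes>\<^bsub>DR\<^esub> y))"
    using zhelobenko ii by (simp add: zhelobenko_def x_def u_def y_def cls_simps)
  with a ii have "q (cls (xx i * psi' i)) = \<ominus>\<^bsub>DR\<^esub> (x \<otimes>\<^bsub>DR\<^esub> (u \<otimes>\<^bsub>DR\<^esub> y)) \<otimes>\<^bsub>DR\<^esub> a"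
    by (simp add: cls_simps)
  moreover have "cls (xx ?i' * psi' ?i') = x \<otimes>\<^bsub>DR\<^esub> (a \<otimes>\<^bsub>DR\<^esub> \<ominus>\<^bsub>DR\<^esub> u)"
    using ii by (simp add: cls_simps psi'_Suc a_def x_def u_def minus_eq minus_add a_ac)
  moreover have "u \<otimes>\<^bsub>DR\<^esub> x = x \<otimes>\<^bsub>DR\<^esub> (u \<ominus>\<^bsub>DR\<^esub> \<one>\<^bsub>DR\<^esub>)"
    using ii unfolding u_def x_def by (intro hd2_xx) auto
  moreover have "(u \<ominus>\<^bsub>DR\<^esub> \<one>\<^bsub>DR\<^esub>) \<otimes>\<^bsub>DR\<^esub> y = \<one>\<^bsub>DR\<^esub>"
  proof -
    have "cls (Const (- 1)) = \<ominus>\<^bsub>DR\<^esub> \<one>\<^bsub>DR\<^esub>"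
      by (simp add: diff_cls_def Diff_h_def alg_cls_const_minus alg_cls_const_one)
    then show ?thesis
      using cls_rel[OF diff_rels.inv_right, of i ?i' "- 1"] ii
      by (simp add: u_def y_def cls_simps minus_eq)
  qed
  moreover have "u \<otimes>\<^bsub>DR\<^esub> a = a \<otimes>\<^bsub>DR\<^esub> u"
    using ii unfolding u_def a_def by (intro tprod_commute) (auto simp: hd2_commute)
  ultimately show ?thesis using twist_identity[OF cl] by (simp flip: u_def)
qed

lemma q_x_psi'_upper:
  "q (cls (xx (i + 1) * psi' (i + 1))) = cls (xx i * psi' i) \<otimes>\<^bsub>DR\<^esub> cls (hd2 i (i + 1))"
proof -
  have ii: "i \<in> {1..n}" "Suc i \<in> {1..n}" using i by auto
  have ga: "alg_gens (tprod (map (hd2 (Suc i) :: nat \<Rightarrow> 'k diff_term) [1..<i])) \<subseteq> diff_gens n"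
    using ii by (intro tprod_gens) auto
  have "q (cls (tprod (map (hd2 (Suc i)) [1..<i]))) = cls (tprod (map (hd2 i) [1..<i]))"
  proof (rule q_tprod)
    fix k assume k: "k \<in> set [1..<i]"
    then have "s k = k" by (auto simp: transpose_def)
    with k ii show "alg_gens (hd2 (Suc i) k) \<subseteq> diff_gens n \<and> alg_gens (hd2 i k) \<subseteq> diff_gens n \<and>
        q (cls (hd2 (Suc i) k)) = cls (hd2 i k)"
      using q_hd2[of "Suc i" k] by auto
  qed
  then have "q (cls (psi' (Suc i))) = cls (psi' i) \<otimes>\<^bsub>DR\<^esub> cls (hd2 i (Suc i))"
    using ii ga q_hd2[of "Suc i" i] by (simp add: psi'_Suc) (simp add: psi'_def)
  moreover have "q (cls (xx (Suc i))) = cls (xx i)"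
    using zhelobenko by (simp add: zhelobenko_def)
  ultimately show ?thesis
    using ii by (simp add: cls_simps(1) m_assoc)
qed

text \<open>For \<open>j > i + 1\<close> the automorphism interchanges the factors of \<open>\<psi>\<^sub>j'\<close> with indices \<open>i\<close> and \<open>i + 1\<close>; they commute.\<close>

lemma q_x_psi'_other:
  assumes j: "j \<in> {1..n} - {i, i + 1}"
  shows "q (cls (xx j * psi' j)) = cls (xx j * psi' j)"
proof -
  have ii: "i \<in> {1..n}" "Suc i \<in> {1..n}" "j \<in> {1..n}" using i j by auto
  have sj: "s j = j" using j by (auto simp: transpose_def)
  have "cls (tprod (map (\<lambda>k. hd2 j (s k)) [1..<j])) = cls (psi' j)"
  proof (cases "j < i")
    case True
    then have "map (\<lambda>k. hd2 j (s k)) [1..<j] = (map (hd2 j) [1..<j] :: 'k diff_term list)"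
      by (auto simp: transpose_def)
    then show ?thesis by (simp only: psi'_def)
  next
    case False
    with j have "Suc i < j" by auto
    have "[1..<j] = [1..<i] @ [i..<j]"
      using upt_add_eq_append[of 1 i "j - i"] \<open>Suc i < j\<close> ii by simp
    also have "[i..<j] = [i, Suc i] @ [Suc (Suc i)..<j]"
      using \<open>Suc i < j\<close> by (simp add: upt_conv_Cons)
    finally have split: "[1..<j] = [1..<i] @ [i, Suc i] @ [Suc (Suc i)..<j]" .
    define A B where "A = (map (hd2 j) [1..<i] :: 'k diff_term list)"
      and "B = (map (hd2 j) [Suc (Suc i)..<j] :: 'k diff_term list)"
    have g: "\<And>t. t \<in> set A \<union> set B \<Longrightarrow> alg_gens t \<subseteq> diff_gens n"
      using ii by (auto simp: A_def B_def)
    have gB: "alg_gens (tprod B) \<subseteq> diff_gens n" using g by (intro tprod_gens) auto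
    have "map (\<lambda>k. hd2 j (s k)) [1..<j] = A @ [hd2 j (Suc i), hd2 j i] @ B"
      unfolding split A_def B_def by (auto simp: transpose_def)
    moreover have "map (hd2 j) [1..<j] = A @ [hd2 j i, hd2 j (Suc i)] @ B"
      unfolding split A_def B_def by simp
    moreover have "cls (tprod ([hd2 j (Suc i), hd2 j i] @ B)) = cls (tprod ([hd2 j i, hd2 j (Suc i)] @ B))"
    proof -
      have gg: "alg_gens (hd2 j i :: 'k diff_term) \<subseteq> diff_gens n"
        "alg_gens (hd2 j (Suc i) :: 'k diff_term) \<subseteq> diff_gens n" using ii by auto
      then show ?thesis
        using gB hd2_commute[of j "Suc i" j i] ii
        by (simp add: cls_simps(1) del: alg_gens_simps(3) flip: m_assoc)
    qed
    ultimately show ?thesis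
      unfolding psi'_def using g ii by (simp only:) (subst (1 2) cls_tprod_append; auto)
  qed
  then have "q (cls (psi' j)) = cls (psi' j)" using q_psi'[OF ii(3)] sj by simp
  moreover have "q (cls (xx j)) = cls (xx j)" using zhelobenko j by (auto simp: zhelobenko_def)
  ultimately show ?thesis using ii by (simp add: cls_simps(1))
qed

end


section \<open>Transport to the localized Weyl algebra\<close>

text \<open>The part of the argument that only concerns the Weyl algebra. Any automorphism with the prescribed values
  on the ground ring, the \<open>\<H>\<^sub>j\<close> and the \<open>X\<^sup>j\<close> will do, in any ring over the Weyl algebra in which the
  denominators become invertible. The value at \<open>X\<^sup>i\<close> is prescribed without an inverse, which is the form in
  which it comes from the ring of differential operators.\<close>

locale weyl_twist = weyl_algebra n ground_ring
  for n :: nat and ground_ring :: "'k::comm_ring_1 itself" +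
  fixes P :: "('p, 'z) ring_scheme" and \<phi> :: "'k weyl_term set \<Rightarrow> 'p" and \<sigma> :: "'p \<Rightarrow> 'p" and i :: nat
  assumes P_ring: "ring P" and \<phi>_hom: "\<phi> \<in> ring_hom W P" and \<phi>_T: "\<phi> ` T_set n \<subseteq> Units P"
    and \<sigma>_iso: "\<sigma> \<in> ring_iso P P" and i: "i \<in> {1..<n}"
    and \<sigma>_const: "\<sigma> (\<phi> (weyl_cls n (Const c))) = \<phi> (weyl_cls n (Const c))"
    and \<sigma>_H: "j \<in> {1..n} \<Longrightarrow> \<sigma> (\<phi> (W_H j)) = \<phi> (W_H (Transposition.transpose i (i + 1) j))"
    and \<sigma>_X_lower: "\<phi> (W_T i (i + 1) 0) \<otimes>\<^bsub>P\<^esub> \<sigma> (\<phi> (W_X i)) = \<phi> (W_X (i + 1))"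
    and \<sigma>_X_upper: "\<sigma> (\<phi> (W_X (i + 1))) = \<phi> (W_X i) \<otimes>\<^bsub>P\<^esub> \<phi> (W_T i (i + 1) 0)"
    and \<sigma>_X_other: "j \<in> {1..n} - {i, i + 1} \<Longrightarrow> \<sigma> (\<phi> (W_X j)) = \<phi> (W_X j)"
begin

abbreviation s :: "nat \<Rightarrow> nat" where "s \<equiv> Transposition.transpose i (i + 1)"
text \<open>These are \<open>\<H>\<^sub>i\<^sub>,\<^sub>i\<^sub>+\<^sub>1\<close> and its negative, which the automorphism interchanges.\<close>

abbreviation u :: 'p where "u \<equiv> \<phi> (W_T i (i + 1) 0)"
abbreviation v :: 'p where "v \<equiv> \<phi> (W_T (i + 1) i 0)"

sublocale P: ring P by (rule P_ring)
sublocale \<phi>: ring_hom_ring W P \<phi> by (intro ring_hom_ringI2 ring_axioms P_ring \<phi>_hom)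
sublocale \<sigma>: ring_hom_ring P P \<sigma>
  using \<sigma>_iso by (intro ring_hom_ringI2 P_ring) (simp add: ring_iso_def)

lemma i_mem: "i \<in> {1..n}" "i + 1 \<in> {1..n}" "Suc i \<in> {1..n}"
  using i by auto

lemma s_mem: "j \<in> {1..n} \<Longrightarrow> s j \<in> {1..n}"
  using i by (auto simp: transpose_def)

lemma unit_X: "j \<in> {1..n} \<Longrightarrow> \<phi> (W_X j) \<in> Units P"
  using \<phi>_T mult_closure_incl[OF ring_axioms T_gens_closed, of "W_X j"] by (auto simp: T_set_def)

lemma \<phi>_T_swap: "j \<in> {1..n} \<Longrightarrow> k \<in> {1..n} \<Longrightarrow> \<phi> (W_T j k c) = \<ominus>\<^bsub>P\<^esub> \<one>\<^bsub>P\<^esub> \<otimes>\<^bsub>P\<^esub> \<phi> (W_T k j (- c))"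
  by (subst T_swap) (simp_all add: P.l_minus)

lemma \<phi>_C: "\<sigma> (\<phi> (W_C c)) = \<phi> (W_C c)"
  by (simp add: W_C_def \<sigma>_const)

lemma \<sigma>_T:
  assumes "j \<in> {1..n}" "k \<in> {1..n}"
  shows "\<sigma> (\<phi> (W_T j k c)) = \<phi> (W_T (s j) (s k) c)"
  using assms
  by (simp only: T_eq[OF assms] T_eq[OF s_mem[OF assms(1)] s_mem[OF assms(2)]] minus_eq)
    (use assms s_mem[OF assms(1)] s_mem[OF assms(2)] in
      \<open>simp add: \<sigma>_H[OF assms(1)] \<sigma>_H[OF assms(2)] \<phi>_C del: One_nat_def\<close>)

text \<open>Only \<open>j < k\<close> occurs among the generating denominators; the transposition of \<open>i\<close> and \<open>i + 1\<close> leads out of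
  this range, so invertibility is needed for both orders.\<close>

lemma units_in_subring:
  assumes K: "subring K P" and t: "\<And>b. b \<in> T0_gens n \<Longrightarrow> \<phi> b \<in> Units (P\<lparr>carrier := K\<rparr>)"
    and jk: "j \<in> {1..n}" "k \<in> {1..n}" "j \<noteq> k"
  shows "\<phi> (W_T j k c) \<in> Units (P\<lparr>carrier := K\<rparr>)"
proof -
  interpret K: ring "P\<lparr>carrier := K\<rparr>" using K by (rule P.subring_is_ring)
  have less: "\<phi> (W_T j k c) \<in> Units (P\<lparr>carrier := K\<rparr>)" if "j \<in> {1..n}" "k \<in> {1..n}" "j < k" for j k c
    using that by (intro t) (auto simp: T0_gens_eq)
  show ?thesis
  proof (cases "j < k")
    case False
    with jk have "\<phi> (W_T k j (- c)) \<in> Units (P\<lparr>carrier := K\<rparr>)" by (intro less) auto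
    then show ?thesis
      using K.Units_m_closed[OF P.neg_one_Units_subring[OF K]] jk by (simp add: \<phi>_T_swap[of j k])
  qed (use jk less in auto)
qed

lemma unit_T:
  assumes "j \<in> {1..n}" "k \<in> {1..n}" "j \<noteq> k"
  shows "\<phi> (W_T j k c) \<in> Units P"
proof -
  have "P\<lparr>carrier := carrier P\<rparr> = P" by simp
  moreover have "\<phi> b \<in> Units P" if "b \<in> T0_gens n" for b
    using \<phi>_T mult_closure_incl[OF ring_axioms T_gens_closed, of b] that by (auto simp: T_set_def)
  ultimately show ?thesis
    using units_in_subring[OF P.carrier_is_subring _ assms] by simp
qed

lemma unit_u: "u \<in> Units P" and unit_v: "v \<in> Units P"
  using i_mem by (auto intro!: unit_T)

lemma \<sigma>_v: "\<sigma> v = u"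
  using i_mem \<sigma>_T[of "i + 1" i 0] by simp

lemma H_T_commute:
  assumes "j \<in> {1..n}" "k \<in> {1..n}" "m \<in> {1..n}"
  shows "\<phi> (W_H m) \<otimes>\<^bsub>P\<^esub> \<phi> (W_T j k c) = \<phi> (W_T j k c) \<otimes>\<^bsub>P\<^esub> \<phi> (W_H m)"
proof -
  have "W_H m \<otimes>\<^bsub>W\<^esub> W_T j k c = W_T j k c \<otimes>\<^bsub>W\<^esub> W_H m"
    using assms
    by (simp add: T_eq l_distr r_distr minus_eq l_minus r_minus HH[of m] C_central[of "W_H m"])
  then have "\<phi> (W_H m \<otimes>\<^bsub>W\<^esub> W_T j k c) = \<phi> (W_T j k c \<otimes>\<^bsub>W\<^esub> W_H m)" by simp
  then show ?thesis using assms by simp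
qed

lemma \<sigma>_D_\<sigma>_X:
  assumes "j \<in> {1..n}"
  shows "\<sigma> (\<phi> (W_D j)) \<otimes>\<^bsub>P\<^esub> \<sigma> (\<phi> (W_X j)) = \<phi> (W_H (s j))"
proof -
  have "\<sigma> (\<phi> (W_D j)) \<otimes>\<^bsub>P\<^esub> \<sigma> (\<phi> (W_X j)) = \<sigma> (\<phi> (W_D j \<otimes>\<^bsub>W\<^esub> W_X j))"
    using assms by simp
  then show ?thesis using assms by (simp only: H_eq[symmetric] \<sigma>_H)
qed

text \<open>As \<open>X\<^sup>j\<close> is invertible, \<open>D\<^sub>j = \<H>\<^sub>j (X\<^sup>j)\<inverse>\<close>; hence the image of \<open>D\<^sub>j\<close> is determined by the images of \<open>\<H>\<^sub>j\<close> and
  \<open>X\<^sup>j\<close>.\<close>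

lemma \<sigma>_D_eqI:
  assumes j: "j \<in> {1..n}" and d: "d \<in> carrier P"
    and eq: "d \<otimes>\<^bsub>P\<^esub> \<sigma> (\<phi> (W_X j)) = \<phi> (W_H (s j))"
  shows "\<sigma> (\<phi> (W_D j)) = d"
proof -
  let ?x = "\<sigma> (\<phi> (W_X j))"
  have x: "?x \<in> Units P" using unit_X[OF j] \<sigma>.homh by (rule ring_hom_Units[rotated])
  have "\<sigma> (\<phi> (W_D j)) \<otimes>\<^bsub>P\<^esub> ?x \<otimes>\<^bsub>P\<^esub> inv\<^bsub>P\<^esub> ?x = d \<otimes>\<^bsub>P\<^esub> ?x \<otimes>\<^bsub>P\<^esub> inv\<^bsub>P\<^esub> ?x"
    using \<sigma>_D_\<sigma>_X[OF j] eq by simp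
  then show ?thesis using x d j by (simp add: P.m_assoc P.Units_closed)
qed

lemma \<sigma>_X_lower': "\<sigma> (\<phi> (W_X i)) = inv\<^bsub>P\<^esub> u \<otimes>\<^bsub>P\<^esub> \<phi> (W_X (i + 1))"
proof -
  have "inv\<^bsub>P\<^esub> u \<otimes>\<^bsub>P\<^esub> (u \<otimes>\<^bsub>P\<^esub> \<sigma> (\<phi> (W_X i))) = inv\<^bsub>P\<^esub> u \<otimes>\<^bsub>P\<^esub> \<phi> (W_X (i + 1))"
    by (simp only: \<sigma>_X_lower)
  then show ?thesis
    using unit_u i_mem(1) by (simp add: P.Units_closed flip: P.m_assoc)
qed

lemma \<sigma>_D_lower: "\<sigma> (\<phi> (W_D i)) = \<phi> (W_D (i + 1)) \<otimes>\<^bsub>P\<^esub> u"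
proof (rule \<sigma>_D_eqI)
  have "\<phi> (W_D (i + 1)) \<otimes>\<^bsub>P\<^esub> u \<otimes>\<^bsub>P\<^esub> \<sigma> (\<phi> (W_X i)) = \<phi> (W_D (i + 1)) \<otimes>\<^bsub>P\<^esub> \<phi> (W_X (i + 1))"
    using i_mem unit_u by (simp add: P.m_assoc P.Units_closed \<sigma>_X_lower[simplified])
  then show "\<phi> (W_D (i + 1)) \<otimes>\<^bsub>P\<^esub> u \<otimes>\<^bsub>P\<^esub> \<sigma> (\<phi> (W_X i)) = \<phi> (W_H (s i))"
    using i_mem by (simp add: H_eq)
qed (use i_mem unit_u P.Units_closed in auto)

lemma \<sigma>_D_upper: "\<sigma> (\<phi> (W_D (i + 1))) = inv\<^bsub>P\<^esub> u \<otimes>\<^bsub>P\<^esub> \<phi> (W_D i)"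
proof (rule \<sigma>_D_eqI)
  have h: "\<phi> (W_H i) \<in> carrier P" "u \<in> carrier P" using i_mem by (auto simp: unit_u P.Units_closed)
  have "inv\<^bsub>P\<^esub> u \<otimes>\<^bsub>P\<^esub> \<phi> (W_D i) \<otimes>\<^bsub>P\<^esub> \<sigma> (\<phi> (W_X (i + 1)))
      = inv\<^bsub>P\<^esub> u \<otimes>\<^bsub>P\<^esub> (\<phi> (W_D i \<otimes>\<^bsub>W\<^esub> W_X i) \<otimes>\<^bsub>P\<^esub> u)"
    unfolding \<sigma>_X_upper using i_mem unit_u by (simp add: P.m_assoc P.Units_closed)
  also have "\<dots> = inv\<^bsub>P\<^esub> u \<otimes>\<^bsub>P\<^esub> (u \<otimes>\<^bsub>P\<^esub> \<phi> (W_H i))"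
    using H_T_commute[of i "i + 1" i 0] i_mem by (simp add: H_eq[symmetric] del: \<phi>.hom_mult)
  also have "\<dots> = \<phi> (W_H i)"
    using unit_u h by (simp flip: P.m_assoc)
  finally show "inv\<^bsub>P\<^esub> u \<otimes>\<^bsub>P\<^esub> \<phi> (W_D i) \<otimes>\<^bsub>P\<^esub> \<sigma> (\<phi> (W_X (i + 1))) = \<phi> (W_H (s (i + 1)))"
    by simp
qed (use i_mem unit_u in auto)

lemma \<sigma>_D_other:
  assumes "j \<in> {1..n} - {i, i + 1}"
  shows "\<sigma> (\<phi> (W_D j)) = \<phi> (W_D j)"
proof (rule \<sigma>_D_eqI)
  have "s j = j" using assms by (auto simp: transpose_def)
  then show "\<phi> (W_D j) \<otimes>\<^bsub>P\<^esub> \<sigma> (\<phi> (W_X j)) = \<phi> (W_H (s j))"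
    using assms \<sigma>_X_other[OF assms] by (simp add: H_eq)
qed (use assms in auto)

text \<open>Both localizations at once: \<open>Y\<close> is the set of the \<open>X\<^sup>j\<close> that are inverted, all or none. That \<open>F\<close> is a ring
  has a different reason in the two cases and is therefore assumed.\<close>

lemma image_fractions:
  assumes Y: "Y = {} \<or> Y = W_X ` {1..n}"
  defines "F \<equiv> fractions W (mult_closure W (T0_gens n \<union> Y)) P \<phi>"
  assumes F: "subring F P"
  shows "\<sigma> ` F = F"
proof -
  let ?B = "T0_gens n \<union> Y" and ?PF = "P\<lparr>carrier := F\<rparr>"
  have B: "?B \<subseteq> carrier W" using T_gens_closed Y by auto
  have "mult_closure W ?B \<subseteq> T_set n"
    using Y T0_subset_T by (auto simp: T0_set_def T_set_def)
  with \<phi>_T have B_units: "\<phi> ` mult_closure W ?B \<subseteq> Units P" by blast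
  interpret F: ring ?PF using F by (rule P.subring_is_ring)
  note FE = subringE[OF F]
  have [simp]: "f \<in> carrier P" if "f \<in> F" for f using that FE(1) by blast
  have \<phi>F: "\<phi> r \<in> F" if "r \<in> carrier W" for r
    unfolding F_def using that by (intro fractions_units(1) ring_axioms P_ring \<phi>_hom B B_units)
  have B_F: "\<phi> b \<in> Units ?PF" if "b \<in> ?B" for b
    unfolding F_def using that mult_closure_incl[OF ring_axioms B]
    by (intro fractions_units(2) ring_axioms P_ring \<phi>_hom B B_units)
  have T_F: "\<phi> (W_T j k c) \<in> Units ?PF" if "j \<in> {1..n}" "k \<in> {1..n}" "j \<noteq> k" for j k c
    using that B_F by (intro units_in_subring F) auto
  have inv_eq: "inv\<^bsub>?PF\<^esub> x = inv\<^bsub>P\<^esub> x" if "x \<in> Units ?PF" for x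
    using P.m_inv_monoid_consistent[OF that subring.axioms(2)[OF F]] .
  have uv: "u \<in> Units ?PF" "v \<in> Units ?PF" using i_mem by (auto intro!: T_F)
  then have inv_uv: "inv\<^bsub>P\<^esub> u \<in> Units ?PF" "inv\<^bsub>P\<^esub> v \<in> Units ?PF"
    using F.Units_inv_Units inv_eq by metis+
  have Units_F: "x \<in> F" if "x \<in> Units ?PF" for x using that by (auto simp: Units_def)
  have mult_F: "x \<otimes>\<^bsub>P\<^esub> y \<in> Units ?PF" if "x \<in> Units ?PF" "y \<in> Units ?PF" for x y
    using F.Units_m_closed[OF that] by simp
  have \<sigma>_inv_v: "\<sigma> (inv\<^bsub>P\<^esub> v) = inv\<^bsub>P\<^esub> u"
    using ring_hom_inv[OF \<sigma>.homh unit_v P_ring P_ring] by (simp only: \<sigma>_v)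
  \<comment> \<open>preimages of the generators within \<open>F\<close>, obtained by solving the formulas for \<open>\<sigma>\<close>\<close>
  have vX: "\<sigma> (v \<otimes>\<^bsub>P\<^esub> \<phi> (W_X i)) = \<phi> (W_X (i + 1))"
    using i_mem(1) unit_v \<sigma>_X_lower by (simp add: P.Units_closed \<sigma>_v[simplified])
  have Xv: "\<sigma> (\<phi> (W_X (i + 1)) \<otimes>\<^bsub>P\<^esub> inv\<^bsub>P\<^esub> v) = \<phi> (W_X i)"
    using i_mem unit_v unit_u \<sigma>_inv_v \<sigma>_X_upper by (simp add: P.Units_closed P.m_assoc)
  have vD: "\<sigma> (v \<otimes>\<^bsub>P\<^esub> \<phi> (W_D (i + 1))) = \<phi> (W_D i)"
    using i_mem unit_v unit_u \<sigma>_D_upper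
    by (simp add: P.Units_closed \<sigma>_v[simplified] flip: P.m_assoc)
  have Dv: "\<sigma> (\<phi> (W_D i) \<otimes>\<^bsub>P\<^esub> inv\<^bsub>P\<^esub> v) = \<phi> (W_D (i + 1))"
    using i_mem unit_v unit_u \<sigma>_inv_v \<sigma>_D_lower by (simp add: P.Units_closed P.m_assoc)
  have X_F: "\<sigma> (\<phi> (W_X j)) \<in> F \<and> \<phi> (W_X j) \<in> \<sigma> ` F" if "j \<in> {1..n}" for j
  proof -
    consider "j = i" | "j = i + 1" | "j \<in> {1..n} - {i, i + 1}" using \<open>j \<in> {1..n}\<close> by blast
    then show ?thesis
    proof cases
      case 1
      have "\<phi> (W_X (i + 1)) \<otimes>\<^bsub>P\<^esub> inv\<^bsub>P\<^esub> v \<in> F" using \<phi>F i_mem inv_uv Units_F FE(6) by simp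
      then have "\<phi> (W_X i) \<in> \<sigma> ` F" using Xv by (metis imageI)
      moreover have "\<sigma> (\<phi> (W_X i)) \<in> F"
        unfolding \<sigma>_X_lower' using \<phi>F i_mem inv_uv Units_F FE(6) by simp
      ultimately show ?thesis using 1 by simp
    next
      case 2
      have "v \<otimes>\<^bsub>P\<^esub> \<phi> (W_X i) \<in> F" using \<phi>F i_mem uv Units_F FE(6) by simp
      then have "\<phi> (W_X (i + 1)) \<in> \<sigma> ` F" using vX by (metis imageI)
      moreover have "\<sigma> (\<phi> (W_X (i + 1))) \<in> F"
        unfolding \<sigma>_X_upper using \<phi>F i_mem uv Units_F FE(6) by simp
      ultimately show ?thesis using 2 by simp
    next
      case 3
      then have "\<phi> (W_X j) \<in> F" using that by (intro \<phi>F) simp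
      then show ?thesis using \<sigma>_X_other[OF 3] by (metis imageI)
    qed
  qed
  have D_F: "\<sigma> (\<phi> (W_D j)) \<in> F \<and> \<phi> (W_D j) \<in> \<sigma> ` F" if "j \<in> {1..n}" for j
  proof -
    consider "j = i" | "j = i + 1" | "j \<in> {1..n} - {i, i + 1}" using \<open>j \<in> {1..n}\<close> by blast
    then show ?thesis
    proof cases
      case 1
      have "v \<otimes>\<^bsub>P\<^esub> \<phi> (W_D (i + 1)) \<in> F" using \<phi>F i_mem uv Units_F FE(6) by simp
      then have "\<phi> (W_D i) \<in> \<sigma> ` F" using vD by (metis imageI)
      moreover have "\<sigma> (\<phi> (W_D i)) \<in> F"
        unfolding \<sigma>_D_lower using \<phi>F i_mem uv Units_F FE(6) by simp
      ultimately show ?thesis using 1 by simp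
    next
      case 2
      have "\<phi> (W_D i) \<otimes>\<^bsub>P\<^esub> inv\<^bsub>P\<^esub> v \<in> F" using \<phi>F i_mem inv_uv Units_F FE(6) by simp
      then have "\<phi> (W_D (i + 1)) \<in> \<sigma> ` F" using Dv by (metis imageI)
      moreover have "\<sigma> (\<phi> (W_D (i + 1))) \<in> F"
        unfolding \<sigma>_D_upper using \<phi>F i_mem inv_uv Units_F FE(6) by simp
      ultimately show ?thesis using 2 by simp
    next
      case 3
      then have "\<phi> (W_D j) \<in> F" using that by (intro \<phi>F) simp
      then show ?thesis using \<sigma>_D_other[OF 3] by (metis imageI)
    qed
  qed
  have X_unit: "\<sigma> (\<phi> (W_X j)) \<in> Units ?PF \<and> \<phi> (W_X j) \<in> \<sigma> ` Units ?PF"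
    if "j \<in> {1..n}" "\<And>j. j \<in> {1..n} \<Longrightarrow> \<phi> (W_X j) \<in> Units ?PF" for j
  proof -
    consider "j = i" | "j = i + 1" | "j \<in> {1..n} - {i, i + 1}" using \<open>j \<in> {1..n}\<close> by blast
    then show ?thesis
    proof cases
      case 1
      have "\<phi> (W_X (i + 1)) \<otimes>\<^bsub>P\<^esub> inv\<^bsub>P\<^esub> v \<in> Units ?PF" by (intro mult_F that(2) i_mem inv_uv)
      then have "\<phi> (W_X i) \<in> \<sigma> ` Units ?PF" using Xv by (metis imageI)
      moreover have "\<sigma> (\<phi> (W_X i)) \<in> Units ?PF"
        unfolding \<sigma>_X_lower' by (intro mult_F that(2) i_mem inv_uv)
      ultimately show ?thesis using 1 by simp
    next
      case 2
      have "v \<otimes>\<^bsub>P\<^esub> \<phi> (W_X i) \<in> Units ?PF" by (intro mult_F that(2) i_mem uv)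
      then have "\<phi> (W_X (i + 1)) \<in> \<sigma> ` Units ?PF" using vX by (metis imageI)
      moreover have "\<sigma> (\<phi> (W_X (i + 1))) \<in> Units ?PF"
        unfolding \<sigma>_X_upper by (intro mult_F that(2) i_mem uv)
      ultimately show ?thesis using 2 by simp
    next
      case 3
      then show ?thesis using \<sigma>_X_other[OF 3] that by (metis imageI)
    qed
  qed
  have T_unit: "\<sigma> (\<phi> b) \<in> Units ?PF \<and> \<phi> b \<in> \<sigma> ` Units ?PF" if "b \<in> T0_gens n" for b
  proof -
    obtain j k c where b: "b = W_T j k c" and jk: "j \<in> {1..n}" "k \<in> {1..n}" "j \<noteq> k"
      using \<open>b \<in> T0_gens n\<close> by (auto simp: T0_gens_eq)
    have sjk: "s j \<in> {1..n}" "s k \<in> {1..n}" "s j \<noteq> s k"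
      using jk s_mem by (blast, blast, metis transpose_involutory)
    have "\<sigma> (\<phi> (W_T (s j) (s k) c)) = \<phi> b"
      unfolding b \<sigma>_T[OF sjk(1,2)] by simp
    then show ?thesis
      unfolding b \<sigma>_T[OF jk(1,2)] using T_F[OF sjk, of c] by (metis imageI)
  qed
  have b_unit: "\<sigma> (\<phi> b) \<in> Units ?PF \<and> \<phi> b \<in> \<sigma> ` Units ?PF" if "b \<in> ?B" for b
  proof (cases "b \<in> T0_gens n")
    case False
    with that Y have "Y = W_X ` {1..n}" "b \<in> W_X ` {1..n}" by auto
    then show ?thesis using X_unit B_F by blast
  qed (rule T_unit)
  have const_F: "\<phi> (weyl_cls n (Const c)) \<in> F" for c by (rule \<phi>F) simp
  have gen: "\<sigma> (\<phi> (weyl_cls n (Gen g))) \<in> F \<and> \<phi> (weyl_cls n (Gen g)) \<in> \<sigma> ` F" if "g \<in> weyl_gens n" for g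
    using that X_F D_F by (auto simp: weyl_gens_def)
  show ?thesis
    unfolding F_def Weyl_def
  proof (rule iso_image_fractions[OF P_ring], goal_cases)
    case 1 show ?case using \<phi>_hom by (simp add: Weyl_def)
  next
    case 2 show ?case using B by (simp add: Weyl_def)
  next
    case 3 show ?case using F by (simp add: F_def Weyl_def)
  next
    case 4 show ?case by (rule \<sigma>_iso)
  next
    case (5 c) show ?case using const_F[of c] by (simp add: F_def Weyl_def weyl_cls_def)
  next
    case (6 c) show ?case using \<sigma>_const by (simp add: weyl_cls_def)
  next
    case (7 g) then show ?case using gen by (simp add: F_def Weyl_def weyl_cls_def)
  next
    case (8 g) then show ?case using gen by (simp add: F_def Weyl_def weyl_cls_def)
  next
    case (9 b) then show ?case using b_unit by (simp add: F_def Weyl_def)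
  next
    case (10 b) then show ?case using b_unit by (simp add: F_def Weyl_def)
  qed
qed

lemma image_T0_fractions:
  "\<sigma> ` fractions W (T0_set n) P \<phi> = fractions W (T0_set n) P \<phi>"
proof -
  have "\<phi> ` T0_set n \<subseteq> Units P" using \<phi>_T T0_subset_T by blast
  then show ?thesis
    using image_fractions[of "{}"] T0_fractions_subring[OF P_ring \<phi>_hom] by (simp add: T0_set_def)
qed

lemma image_T_fractions:
  "subring (fractions W (T_set n) P \<phi>) P \<Longrightarrow>
    \<sigma> ` fractions W (T_set n) P \<phi> = fractions W (T_set n) P \<phi>"
  using image_fractions[of "W_X ` {1..n}"] by (simp add: T_set_def)

end


lemma transport_iso:
  assumes "ring P" "\<mu> \<in> ring_iso P Q" "f \<in> ring_iso Q Q"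
  shows "transport P \<mu> f \<in> ring_iso P P"
  unfolding transport_def
  using ring_iso_set_trans[OF assms(2) ring_iso_set_trans[OF assms(3) ring_iso_set_sym[OF assms(1,2)]]]
  by (simp add: comp_assoc)

lemma transport_intertwines:
  assumes "\<mu> \<in> ring_iso P Q" "f \<in> ring_iso Q Q" "p \<in> carrier P"
  shows "\<mu> (transport P \<mu> f p) = f (\<mu> p)"
proof -
  have "\<mu> ` carrier P = carrier Q" using assms(1) by (auto simp: ring_iso_def bij_betw_def)
  moreover have "f (\<mu> p) \<in> carrier Q"
    using assms by (auto simp: ring_iso_def intro: ring_hom_closed)
  ultimately show ?thesis by (simp add: transport_def f_inv_into_f)
qed

theorem mainTheorem7:
  fixes n :: nat
    and Q :: "('q, 'y) ring_scheme" and \<iota> :: "'k::{idom, ring_char_0} diff_term set \<Rightarrow> 'q"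
    and L :: "('l, 'x) ring_scheme" and l :: "'k weyl_term set \<Rightarrow> 'l"
    and q :: "nat \<Rightarrow> 'k diff_term set \<Rightarrow> 'k diff_term set"
    and qS :: "nat \<Rightarrow> 'q \<Rightarrow> 'q"
    and \<mu> :: "('k, 'l) pw \<Rightarrow> 'q"
  defines "P \<equiv> PW n L l"
    and "w \<equiv> PW_weyl n L l"
    and "\<sigma> \<equiv> \<lambda>i. transport (PW n L l) \<mu> (qS i)"
  assumes n: "n \<ge> 1"
    and Q: "ore_localization (Diff_h n) (S_x n) Q \<iota>"
    and L: "ore_localization (Weyl n) (T_set n) L l"
    and q: "\<And>i. i \<in> {1..<n} \<Longrightarrow> zhelobenko n i (q i)"
    and q_braid: "braid_action n (Diff_h n) (\<lambda>c. diff_cls n (Const c)) q"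
    and qS_iso: "\<And>i. i \<in> {1..<n} \<Longrightarrow> qS i \<in> ring_iso Q Q"
    and qS_extends: "\<And>i d. i \<in> {1..<n} \<Longrightarrow> d \<in> carrier (Diff_h n) \<Longrightarrow> qS i (\<iota> d) = \<iota> (q i d)"
    and \<mu>: "is_mu n L l Q \<iota> \<mu>"
  shows "braid_action n P (\<lambda>c. PW_cls n L l (Const c)) \<sigma>
    \<and> (\<forall>i\<in>{1..<n}.
        \<sigma> i ` (PW_emb n L l ` carrier L) = PW_emb n L l ` carrier L
      \<and> \<sigma> i ` (PW_emb n L l ` fractions (Weyl n) (T0_set n) L l)
          = PW_emb n L l ` fractions (Weyl n) (T0_set n) L l
      \<and> \<sigma> i (w (wX i)) = inv\<^bsub>P\<^esub> (w (wH i - wH (i + 1))) \<otimes>\<^bsub>P\<^esub> w (wX (i + 1))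
      \<and> \<sigma> i (w (wX (i + 1))) = w (wX i) \<otimes>\<^bsub>P\<^esub> w (wH i - wH (i + 1))
      \<and> (\<forall>j\<in>{1..n} - {i, i + 1}. \<sigma> i (w (wX j)) = w (wX j))
      \<and> \<sigma> i (w (wD i)) = w (wD (i + 1)) \<otimes>\<^bsub>P\<^esub> w (wH i - wH (i + 1))
      \<and> \<sigma> i (w (wD (i + 1))) = inv\<^bsub>P\<^esub> (w (wH i - wH (i + 1))) \<otimes>\<^bsub>P\<^esub> w (wD i)
      \<and> (\<forall>j\<in>{1..n} - {i, i + 1}. \<sigma> i (w (wD j)) = w (wD j)))"
proof -
  have \<sigma>_eq: "\<sigma> i = transport P \<mu> (qS i)" for i by (simp add: \<sigma>_def P_def)
  interpret weyl_algebra n "TYPE('k)" .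
  interpret diff: diff_algebra n "TYPE('k)" .
  have Q_ring: "ring Q" and \<iota>: "\<iota> \<in> ring_hom (Diff_h n) Q" and \<iota>_S: "\<iota> ` S_x n \<subseteq> Units Q"
    and Q_fractions: "carrier Q = fractions (Diff_h n) (S_x n) Q \<iota>"
    using Q by (auto simp: ore_localization_def)
  have L_ring: "ring L" and l: "l \<in> ring_hom W L" and l_T: "l ` T_set n \<subseteq> Units L"
    and L_fractions: "carrier L = fractions W (T_set n) L l"
    using L by (auto simp: ore_localization_def)
  have P_ring: "ring P" unfolding P_def by (rule PW_ring)
  define e where "e = PW_emb n L l"
  define \<phi> where "\<phi> = e \<circ> l"
  have e: "e \<in> ring_hom L P" unfolding e_def P_def by (rule PW_emb_hom[OF L_ring])
  have \<phi>: "\<phi> \<in> ring_hom W P" unfolding \<phi>_def using l e by (rule ring_hom_trans)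
  have w: "w t = \<phi> (weyl_cls n t)" for t by (simp add: w_def PW_weyl_def \<phi>_def e_def)
  have \<phi>_T: "\<phi> ` T_set n \<subseteq> Units P"
    using l_T ring_hom_Units[OF e] by (auto simp: \<phi>_def)
  have \<phi>_const: "\<phi> (weyl_cls n (Const c)) = PW_cls n L l (Const c)" for c
    unfolding \<phi>_def e_def using PW_emb_const[OF L_ring l] by simp
  have e_L: "e ` carrier L = fractions W (T_set n) P \<phi>"
    unfolding L_fractions \<phi>_def by (rule fractions_image[OF L_ring P_ring e l l_T T_set_closed])
  have e_T0: "e ` fractions W (T0_set n) L l = fractions W (T0_set n) P \<phi>"
    unfolding \<phi>_def using T0_subset_T l_T T_set_closed by (intro fractions_image L_ring P_ring e l) auto
  \<comment> \<open>for the full localization, closure under the ring operations is part of the hypothesis, not an Ore computation\<close>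
  have L_subring: "subring (e ` carrier L) P"
  proof -
    interpret e: ring_hom_ring L P e by (intro ring_hom_ringI2 L_ring P_ring e)
    show ?thesis by (rule e.img_is_subring[OF e.R.carrier_is_subring])
  qed
  have \<mu>_iso: "\<mu> \<in> ring_iso P Q" and \<mu>_const: "\<mu> (PW_cls n L l (Const c)) = \<iota> (diff_cls n (Const c))"
    and \<mu>_X: "j \<in> {1..n} \<Longrightarrow> \<mu> (\<phi> (W_X j)) = \<iota> (diff_cls n (xx j * psi' j))"
    and \<mu>_H: "j \<in> {1..n} \<Longrightarrow> \<mu> (\<phi> (W_H j)) = \<iota> (diff_cls n (hh j))" for c j
    using \<mu> unfolding is_mu_def by (auto simp flip: P_def w_def w)
  have S_closed: "(S_x n :: 'k diff_term set set) \<subseteq> carrier (Diff_h n)"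
    unfolding S_x_def by (rule mult_closure_closed[OF diff.ring_axioms]) auto
  have \<sigma>_iso: "\<sigma> i \<in> ring_iso P P" if "i \<in> {1..<n}" for i
    unfolding \<sigma>_eq by (rule transport_iso[OF P_ring \<mu>_iso qS_iso[OF that]])
  have \<mu>\<sigma>: "\<mu> (\<sigma> i p) = qS i (\<mu> p)" if "i \<in> {1..<n}" "p \<in> carrier P" for i p
    unfolding \<sigma>_eq by (rule transport_intertwines[OF \<mu>_iso qS_iso[OF that(1)] that(2)])
  have \<sigma>_closed: "\<sigma> i p \<in> carrier P" if "i \<in> {1..<n}" "p \<in> carrier P" for i p
    using \<sigma>_iso[OF that(1)] that(2) by (auto simp: ring_iso_def intro: ring_hom_closed)
  have \<mu>_inj: "x = y" if "\<mu> x = \<mu> y" "x \<in> carrier P" "y \<in> carrier P" for x y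
    using \<mu>_iso that by (auto simp: ring_iso_def bij_betw_def inj_on_def)
  have \<mu>_closed: "\<mu> p \<in> carrier Q" if "p \<in> carrier P" for p
    using \<mu>_iso that by (auto simp: ring_iso_def intro: ring_hom_closed)
  interpret P: ring P by (rule P_ring)
  interpret \<phi>: ring_hom_ring W P \<phi> by (intro ring_hom_ringI2 ring_axioms P_ring \<phi>)
  interpret \<mu>: ring_hom_ring P Q \<mu>
    using \<mu>_iso by (intro ring_hom_ringI2 P_ring Q_ring) (simp add: ring_iso_def)
  interpret \<iota>: ring_hom_ring "Diff_h n" Q \<iota> by (intro ring_hom_ringI2 diff.ring_axioms Q_ring \<iota>)
  have q_hom: "q i \<in> ring_hom (Diff_h n) (Diff_h n)" if "i \<in> {1..<n}" for i
    using q[OF that] by (simp add: zhelobenko_def ring_iso_def)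
  have q_closed: "q i d \<in> carrier (Diff_h n)" if "i \<in> {1..<n}" "d \<in> carrier (Diff_h n)" for i d
    using ring_hom_closed[OF q_hom] that by blast
  have qS_hom: "qS i \<in> ring_hom Q Q" if "i \<in> {1..<n}" for i
    using qS_iso[OF that] by (simp add: ring_iso_def)
  note Q_eqI = ring_hom_fractions_eq[OF Q_ring Q_ring _ _ \<iota> \<iota>_S S_closed, folded Q_fractions]
  have \<sigma>_const: "\<sigma> i (PW_cls n L l (Const c)) = PW_cls n L l (Const c)" if "i \<in> {1..<n}" for i c
  proof (rule \<mu>_inj)
    have "q i (diff_cls n (Const c)) = diff_cls n (Const c)" using q[OF that] by (simp add: zhelobenko_def)
    moreover have cl: "PW_cls n L l (Const c) \<in> carrier P" by (simp flip: \<phi>_const)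
    ultimately show "\<mu> (\<sigma> i (PW_cls n L l (Const c))) = \<mu> (PW_cls n L l (Const c))"
      using that by (simp add: \<mu>\<sigma> \<mu>_const qS_extends)
    show "\<sigma> i (PW_cls n L l (Const c)) \<in> carrier P" using \<sigma>_closed[OF that cl] .
    show "PW_cls n L l (Const c) \<in> carrier P" by (rule cl)
  qed
  have braid: "braid_action n P (\<lambda>c. PW_cls n L l (Const c)) \<sigma>"
    unfolding braid_action_def
  proof (intro conjI ballI allI impI; (elim conjE)?)
    fix i j p assume ij: "i \<in> {1..<n}" "j \<in> {1..<n}" "i + 1 < j" and p: "p \<in> carrier P"
    have "(qS i \<circ> qS j) (\<mu> p) = (qS j \<circ> qS i) (\<mu> p)"
    proof (rule Q_eqI[of "qS i \<circ> qS j" "qS j \<circ> qS i"])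
      show "(qS i \<circ> qS j) (\<iota> d) = (qS j \<circ> qS i) (\<iota> d)" if "d \<in> carrier (Diff_h n)" for d
      proof -
        have "q i (q j d) = q j (q i d)"
          using q_braid ij that unfolding braid_action_def by blast
        then show ?thesis using ij that by (simp add: qS_extends q_closed)
      qed
      show "qS i \<circ> qS j \<in> ring_hom Q Q" "qS j \<circ> qS i \<in> ring_hom Q Q"
        using ij by (intro ring_hom_trans[OF qS_hom qS_hom]; simp)+
      show "\<mu> p \<in> carrier Q" using p by (rule \<mu>_closed)
    qed
    then show "\<sigma> i (\<sigma> j p) = \<sigma> j (\<sigma> i p)"
      using ij p by (intro \<mu>_inj) (simp_all add: \<mu>\<sigma> \<sigma>_closed)
  next
    fix i p assume i: "1 \<le> i" "i + 1 < n" and p: "p \<in> carrier P"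
    then have ij: "i \<in> {1..<n}" "i + 1 \<in> {1..<n}" by auto
    have "(qS i \<circ> (qS (i + 1) \<circ> qS i)) (\<mu> p) = (qS (i + 1) \<circ> (qS i \<circ> qS (i + 1))) (\<mu> p)"
    proof (rule Q_eqI[of "qS i \<circ> (qS (i + 1) \<circ> qS i)" "qS (i + 1) \<circ> (qS i \<circ> qS (i + 1))"])
      show "(qS i \<circ> (qS (i + 1) \<circ> qS i)) (\<iota> d) = (qS (i + 1) \<circ> (qS i \<circ> qS (i + 1))) (\<iota> d)"
        if "d \<in> carrier (Diff_h n)" for d
      proof -
        have "q i (q (i + 1) (q i d)) = q (i + 1) (q i (q (i + 1) d))"
          using q_braid i that unfolding braid_action_def by blast
        then show ?thesis using ij that by (simp add: qS_extends q_closed)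
      qed
      show "qS i \<circ> (qS (i + 1) \<circ> qS i) \<in> ring_hom Q Q" "qS (i + 1) \<circ> (qS i \<circ> qS (i + 1)) \<in> ring_hom Q Q"
        by (intro ring_hom_trans[OF ring_hom_trans[OF qS_hom qS_hom] qS_hom] ij)+
      show "\<mu> p \<in> carrier Q" using p by (rule \<mu>_closed)
    qed
    then show "\<sigma> i (\<sigma> (i + 1) (\<sigma> i p)) = \<sigma> (i + 1) (\<sigma> i (\<sigma> (i + 1) p))"
      using ij[simplified] p by (intro \<mu>_inj) (simp_all add: \<mu>\<sigma> \<sigma>_closed)
  qed (use \<sigma>_iso \<sigma>_const in auto)
  have twist: "weyl_twist n P \<phi> (\<sigma> i) i" if i: "i \<in> {1..<n}" for i
  proof -
    interpret z: zhelobenko_automorphism n "TYPE('k)" i "q i" by standard (use i q in auto)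
    have im: "i \<in> {1..n}" "i + 1 \<in> {1..n}" "Suc i \<in> {1..n}" using i by auto
    \<comment> \<open>all identities for \<open>\<sigma> i\<close> are checked after applying the injective map \<open>\<mu>\<close>\<close>
    have \<mu>_u: "\<mu> (\<phi> (W_T i (i + 1) 0)) = \<iota> (diff_cls n (hd2 i (i + 1)))"
      using im by (simp add: T_eq C_simps(4) \<mu>_H diff.cls_simps minus_eq P.minus_eq \<mu>.S.minus_eq diff.minus_eq)
    show ?thesis
    proof
      show "\<phi> \<in> ring_hom W P" "\<phi> ` T_set n \<subseteq> Units P" "\<sigma> i \<in> ring_iso P P" "i \<in> {1..<n}"
        by (fact \<phi> \<phi>_T \<sigma>_iso[OF i] i)+
      show "\<sigma> i (\<phi> (weyl_cls n (Const c))) = \<phi> (weyl_cls n (Const c))" for c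
        using \<sigma>_const[OF i] by (simp add: \<phi>_const)
      show "\<sigma> i (\<phi> (W_H j)) = \<phi> (W_H (z.s j))" if j: "j \<in> {1..n}" for j
      proof (rule \<mu>_inj)
        show "\<mu> (\<sigma> i (\<phi> (W_H j))) = \<mu> (\<phi> (W_H (z.s j)))"
          using j i by (simp only: \<mu>_H[OF j] \<mu>_H[OF z.s_range[OF j]] \<mu>\<sigma> \<phi>.hom_closed weyl_closed wH_gens
              qS_extends diff.cls_closed alg_term.set diff.diff_gens empty_subsetI insert_subset z.q_hh simp_thms)
        show "\<sigma> i (\<phi> (W_H j)) \<in> carrier P" using i j by (intro \<sigma>_closed) auto
        show "\<phi> (W_H (z.s j)) \<in> carrier P"
          by (intro \<phi>.hom_closed weyl_closed wH_gens z.s_range j)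
      qed
      have \<mu>\<sigma>_X: "\<mu> (\<sigma> i (\<phi> (W_X j))) = \<iota> (q i (diff_cls n (xx j * psi' j)))" if j: "j \<in> {1..n}" for j
        using i j by (simp add: \<mu>\<sigma> \<mu>_X qS_extends)
      have q_cl: "q i (diff_cls n (xx j * psi' j)) \<in> carrier (Diff_h n)" if "j \<in> {1..n}" for j
        using i that by (intro q_closed) auto
      show "\<phi> (W_T i (i + 1) 0) \<otimes>\<^bsub>P\<^esub> \<sigma> i (\<phi> (W_X i)) = \<phi> (W_X (i + 1))"
      proof (rule \<mu>_inj)
        have "\<mu> (\<phi> (W_T i (i + 1) 0) \<otimes>\<^bsub>P\<^esub> \<sigma> i (\<phi> (W_X i)))
            = \<iota> (diff_cls n (hd2 i (i + 1)) \<otimes>\<^bsub>Diff_h n\<^esub> q i (diff_cls n (xx i * psi' i)))"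
          using im i q_cl[of i] by (simp add: \<sigma>_closed \<mu>_u[simplified] \<mu>\<sigma>_X)
        also have "\<dots> = \<mu> (\<phi> (W_X (i + 1)))"
          unfolding z.q_x_psi'_lower \<mu>_X[OF im(2)] ..
        finally show "\<mu> (\<phi> (W_T i (i + 1) 0) \<otimes>\<^bsub>P\<^esub> \<sigma> i (\<phi> (W_X i))) = \<mu> (\<phi> (W_X (i + 1)))" .
      qed (use im i \<sigma>_closed in auto)
      show "\<sigma> i (\<phi> (W_X (i + 1))) = \<phi> (W_X i) \<otimes>\<^bsub>P\<^esub> \<phi> (W_T i (i + 1) 0)"
      proof (rule \<mu>_inj)
        have "\<mu> (\<sigma> i (\<phi> (W_X (i + 1))))
            = \<iota> (diff_cls n (xx i * psi' i) \<otimes>\<^bsub>Diff_h n\<^esub> diff_cls n (hd2 i (i + 1)))"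
          unfolding \<mu>\<sigma>_X[OF im(2)] z.q_x_psi'_upper ..
        also have "\<dots> = \<mu> (\<phi> (W_X i) \<otimes>\<^bsub>P\<^esub> \<phi> (W_T i (i + 1) 0))"
          using im by (simp add: \<mu>_u[simplified] \<mu>_X)
        finally show "\<mu> (\<sigma> i (\<phi> (W_X (i + 1)))) = \<mu> (\<phi> (W_X i) \<otimes>\<^bsub>P\<^esub> \<phi> (W_T i (i + 1) 0))" .
      qed (use im i \<sigma>_closed in auto)
      show "\<sigma> i (\<phi> (W_X j)) = \<phi> (W_X j)" if j: "j \<in> {1..n} - {i, i + 1}" for j
      proof (rule \<mu>_inj)
        show "\<mu> (\<sigma> i (\<phi> (W_X j))) = \<mu> (\<phi> (W_X j))"
          using j \<mu>\<sigma>_X[of j] \<mu>_X[of j] z.q_x_psi'_other[OF j] by simp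
      qed (use i j \<sigma>_closed in auto)
    qed
  qed
  have u: "\<phi> (weyl_cls n (wH i - wH (i + 1))) = \<phi> (W_T i (i + 1) 0)" if "i \<in> {1..<n}" for i
    using that by (subst T_zero) auto
  show ?thesis
  proof (intro conjI ballI braid)
    fix i assume i: "i \<in> {1..<n}"
    interpret weyl_twist n "TYPE('k)" P \<phi> "\<sigma> i" i by (rule twist[OF i])
    show "\<sigma> i ` (PW_emb n L l ` carrier L) = PW_emb n L l ` carrier L"
      using image_T_fractions L_subring by (simp flip: e_def add: e_L)
    show "\<sigma> i ` (PW_emb n L l ` fractions (Weyl n) (T0_set n) L l)
        = PW_emb n L l ` fractions (Weyl n) (T0_set n) L l"
      using image_T0_fractions by (simp flip: e_def add: e_T0)
    show "\<sigma> i (w (wX i)) = inv\<^bsub>P\<^esub> (w (wH i - wH (i + 1))) \<otimes>\<^bsub>P\<^esub> w (wX (i + 1))"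
      unfolding w u[OF i] by (rule \<sigma>_X_lower')
    show "\<sigma> i (w (wX (i + 1))) = w (wX i) \<otimes>\<^bsub>P\<^esub> w (wH i - wH (i + 1))"
      unfolding w u[OF i] by (rule \<sigma>_X_upper)
    show "\<sigma> i (w (wD i)) = w (wD (i + 1)) \<otimes>\<^bsub>P\<^esub> w (wH i - wH (i + 1))"
      unfolding w u[OF i] by (rule \<sigma>_D_lower)
    show "\<sigma> i (w (wD (i + 1))) = inv\<^bsub>P\<^esub> (w (wH i - wH (i + 1))) \<otimes>\<^bsub>P\<^esub> w (wD i)"
      unfolding w u[OF i] by (rule \<sigma>_D_upper)
    show "\<sigma> i (w (wX j)) = w (wX j)" if "j \<in> {1..n} - {i, i + 1}" for j
      unfolding w using that by (rule \<sigma>_X_other)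
    show "\<sigma> i (w (wD j)) = w (wD j)" if "j \<in> {1..n} - {i, i + 1}" for j
      unfolding w using that by (rule \<sigma>_D_other)
  qed
qed

end
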